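(* Let $G$ be a finite group of order $n$. Then $$\operatorname{sdim}(\mathcal{P}_R(G))=\begin{cases} 2^k-k, & \text{if } G\cong\mathbb{Z}_{2^k} \text{ for some } k\ge 1;\\ 2^{t+2}-t-1, & \text{if } G\cong Q_{4\cdot 2^t} \text{ for some } t\ge 1;\\ n-\max\{\Omega(m): m\in\pi_e(G)\}-1, & \text{otherwise.}\end{cases}$$
   Context: All groups are finite. The reduced power graph $\mathcal{P}_R(G)$ has vertex set $G$, two distinct vertices $x,y$ being adjacent iff $\langle x\rangle\subsetneq\langle y\rangle$ or $\langle y\rangle\subsetneq\langle x\rangle$. $\mathbb{Z}_m$ is the cyclic group of order $m$. For $n\ge 2$, the generalized quaternion group is $Q_{4n}=\langle x,y: x^n=y^2, x^{2n}=y^4=e, y^{-1}xy=x^{-1}\rangle$ (order $4n$). $\pi_e(G)$ is the set of element orders of $G$; $\Omega(m)$ is the number of prime factors of $m$ counted with multiplicity. For a graph $\Gamma$ and vertices $x,y,z$, $z$ strongly resolves $x$ and $y$ if there is a shortest path from $z$ to $x$ containing $y$ or a shortest path from $z$ to $y$ containing $x$; a strong resolving set is a vertex set $S$ such that every pair of distinct vertices is strongly resolved by some vertex of $S$; $\operatorname{sdim}(\Gamma)$ is the minimum size of a strong resolving set. *)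

theory Defs
  imports
    "HOL-Algebra.Elementary_Groups"
    "HOL-Algebra.Multiplicative_Group"
    "HOL-Computational_Algebra.Primes"
    "Graph_Theory.Pair_Digraph"
    "Graph_Theory.Vertex_Walk"
begin

section \<open>Strong metric dimension\<close>

text \<open>
  An undirected simple graph is represented as a symmetric loop-free digraph without
  parallel arcs (locale \<open>pair_graph\<close>); paths are given by their list of vertices.
\<close>

definition shortest_path :: "'a pair_pre_digraph \<Rightarrow> 'a \<Rightarrow> 'a list \<Rightarrow> 'a \<Rightarrow> bool" where
  "shortest_path \<Gamma> u p v \<longleftrightarrow>
     vpath p (with_proj \<Gamma>) \<and> hd p = u \<and> last p = v \<and>
     (\<forall>q. vpath q (with_proj \<Gamma>) \<and> hd q = u \<and> last q = v \<longrightarrow> vwalk_length p \<le> vwalk_length q)"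

definition strongly_resolves :: "'a pair_pre_digraph \<Rightarrow> 'a \<Rightarrow> 'a \<Rightarrow> 'a \<Rightarrow> bool" where
  "strongly_resolves \<Gamma> z x y \<longleftrightarrow>
     (\<exists>p. shortest_path \<Gamma> z p x \<and> y \<in> set p) \<or> (\<exists>p. shortest_path \<Gamma> z p y \<and> x \<in> set p)"

definition strong_resolving_set :: "'a pair_pre_digraph \<Rightarrow> 'a set \<Rightarrow> bool" where
  "strong_resolving_set \<Gamma> S \<longleftrightarrow>
     S \<subseteq> pverts \<Gamma> \<and>
     (\<forall>x\<in>pverts \<Gamma>. \<forall>y\<in>pverts \<Gamma>. x \<noteq> y \<longrightarrow> (\<exists>z\<in>S. strongly_resolves \<Gamma> z x y))"

definition sdim :: "'a pair_pre_digraph \<Rightarrow> nat" where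
  "sdim \<Gamma> = (LEAST k. \<exists>S. finite S \<and> strong_resolving_set \<Gamma> S \<and> card S = k)"


section \<open>The reduced power graph\<close>

definition reduced_power_graph :: "('a, 'b) monoid_scheme \<Rightarrow> 'a pair_pre_digraph" where
  "reduced_power_graph G =
     \<lparr> pverts = carrier G,
       parcs = {(x, y). x \<in> carrier G \<and> y \<in> carrier G \<and> x \<noteq> y \<and>
                  (generate G {x} \<subset> generate G {y} \<or> generate G {y} \<subset> generate G {x})} \<rparr>"

lemma pair_graph_reduced_power_graph:
  assumes "finite (carrier G)"
  shows "pair_graph (reduced_power_graph G)"
proof
  show "finite (parcs (reduced_power_graph G))"
    by (rule finite_subset[of _ "carrier G \<times> carrier G"])
       (use assms in \<open>auto simp: reduced_power_graph_def\<close>)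
  show "symmetric (with_proj (reduced_power_graph G))"
    by (auto simp: reduced_power_graph_def symmetric_def sym_def)
qed (use assms in \<open>auto simp: reduced_power_graph_def\<close>)

definition element_orders :: "('a, 'b) monoid_scheme \<Rightarrow> nat set" where
  "element_orders G = group.ord G ` carrier G"

definition num_prime_factors :: "nat \<Rightarrow> nat" where
  "num_prime_factors m = size (prime_factorization m)"


section \<open>Groups given by generators and relations\<close>

text \<open>
  A word over the generators is a list of pairs \<open>(g, b)\<close>; the letter \<open>(g, True)\<close>
  stands for \<open>g\<close> and \<open>(g, False)\<close> for the inverse of \<open>g\<close>. A relation \<open>u = v\<close> is the
  pair \<open>(u, v)\<close>. The presented group consists of the words modulo the least congruence
  containing the relations and the free cancellations.
\<close>

type_synonym 'g word = "('g \<times> bool) list"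

inductive word_eq :: "('g word \<times> 'g word) set \<Rightarrow> 'g word \<Rightarrow> 'g word \<Rightarrow> bool"
  for R where
    refl: "word_eq R u u"
  | sym: "word_eq R u v \<Longrightarrow> word_eq R v u"
  | trans: "word_eq R u v \<Longrightarrow> word_eq R v w \<Longrightarrow> word_eq R u w"
  | mult: "word_eq R u v \<Longrightarrow> word_eq R u' v' \<Longrightarrow> word_eq R (u @ u') (v @ v')"
  | cancel: "word_eq R [(g, b), (g, \<not> b)] []"
  | rel: "(u, v) \<in> R \<Longrightarrow> word_eq R u v"

definition word_class :: "('g word \<times> 'g word) set \<Rightarrow> 'g word \<Rightarrow> 'g word set" where
  "word_class R u = {v. word_eq R u v}"

definition presented_group :: "('g word \<times> 'g word) set \<Rightarrow> 'g word set monoid" where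
  "presented_group R =
     \<lparr> carrier = range (word_class R),
       monoid.mult = (\<lambda>A B. \<Union>u\<in>A. \<Union>v\<in>B. word_class R (u @ v)),
       one = word_class R [] \<rparr>"

lemma word_class_eq_iff: "word_class R u = word_class R v \<longleftrightarrow> word_eq R u v"
  unfolding word_class_def
  by (metis (mono_tags, lifting) Collect_cong mem_Collect_eq word_eq.refl word_eq.sym word_eq.trans)

lemma mult_presented_group:
  "word_class R u \<otimes>\<^bsub>presented_group R\<^esub> word_class R v = word_class R (u @ v)"
proof -
  have "(\<Union>v'\<in>word_class R v. word_class R (u' @ v')) = word_class R (u @ v)"
    if u': "u' \<in> word_class R u" for u'
  proof -
    have "word_class R (u' @ v') = word_class R (u @ v)" if "v' \<in> word_class R v" for v'
      using u' that word_eq.sym[OF word_eq.mult[of R u u' v v']]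
      by (simp only: word_class_eq_iff) (simp add: word_class_def)
    moreover have "v \<in> word_class R v"
      by (simp add: word_class_def word_eq.refl)
    ultimately show ?thesis by (intro SUP_eq_const) auto
  qed
  moreover have "u \<in> word_class R u"
    by (simp add: word_class_def word_eq.refl)
  ultimately have "(\<Union>u'\<in>word_class R u. \<Union>v'\<in>word_class R v. word_class R (u' @ v')) =
      word_class R (u @ v)"
    by (metis (no_types, lifting) SUP_eq_const empty_iff)
  then show ?thesis
    by (simp only: presented_group_def monoid.simps)
qed

lemma word_eq_left_inverse:
  "word_eq R (rev (map (\<lambda>(g, b). (g, \<not> b)) u) @ u) []"
proof (induction u)
  case Nil
  show ?case by (simp add: word_eq.refl)
next
  case (Cons l u)
  obtain g b where l: "l = (g, b)" by fastforce
  let ?u' = "rev (map (\<lambda>(g, b). (g, \<not> b)) u)"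
  have "word_eq R ([(g, \<not> b), (g, b)] @ u) ([] @ u)"
    by (rule word_eq.mult) (use word_eq.cancel[of R g "\<not> b"] word_eq.refl in auto)
  from word_eq.mult[OF word_eq.refl[of R ?u'] this]
  have "word_eq R (?u' @ [(g, \<not> b), (g, b)] @ u) (?u' @ u)" by simp
  from word_eq.trans[OF this Cons.IH] show ?case by (simp add: l)
qed

lemma group_presented_group: "group (presented_group R)"
proof (rule groupI)
  have carrier: "carrier (presented_group R) = range (word_class R)"
    and one: "\<one>\<^bsub>presented_group R\<^esub> = word_class R []"
    by (simp_all add: presented_group_def)
  note simps = carrier one mult_presented_group
  fix A assume A: "A \<in> carrier (presented_group R)"
  then obtain u where u: "A = word_class R u" by (auto simp: carrier)
  show "\<one>\<^bsub>presented_group R\<^esub> \<otimes>\<^bsub>presented_group R\<^esub> A = A"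
    by (simp add: u simps)
  show "\<exists>B\<in>carrier (presented_group R). B \<otimes>\<^bsub>presented_group R\<^esub> A = \<one>\<^bsub>presented_group R\<^esub>"
    using word_eq_left_inverse[of R u]
    by (intro bexI[of _ "word_class R (rev (map (\<lambda>(g, b). (g, \<not> b)) u))"])
       (simp add: u simps word_class_eq_iff, simp add: carrier)
  fix B assume B: "B \<in> carrier (presented_group R)"
  show "A \<otimes>\<^bsub>presented_group R\<^esub> B \<in> carrier (presented_group R)"
    using A B by (auto simp: simps)
  fix C assume C: "C \<in> carrier (presented_group R)"
  show "A \<otimes>\<^bsub>presented_group R\<^esub> B \<otimes>\<^bsub>presented_group R\<^esub> C =
        A \<otimes>\<^bsub>presented_group R\<^esub> (B \<otimes>\<^bsub>presented_group R\<^esub> C)"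
    using A B C by (auto simp: simps)
qed (simp add: presented_group_def)


section \<open>Generalized quaternion groups\<close>

datatype quaternion_gen = gen_x | gen_y

text \<open>
  \<open>generalized_quaternion n\<close> is the group \<open>Q\<^sub>4\<^sub>n\<close> of order \<open>4 * n\<close>, for \<open>n \<ge> 2\<close>.
\<close>

definition generalized_quaternion :: "nat \<Rightarrow> quaternion_gen word set monoid" where
  "generalized_quaternion n = presented_group
     { (replicate n (gen_x, True), [(gen_y, True), (gen_y, True)]),
       (replicate (2 * n) (gen_x, True), []),
       (replicate 4 (gen_y, True), []),
       ([(gen_y, False), (gen_x, True), (gen_y, True)], [(gen_x, False)]) }"

end

theory Submission
  imports Defs "HOL-Algebra.Sylow" "HOL-Algebra.Group_Action"
begin

text \<open>
  The identity is adjacent to all other vertices of the reduced power graph, so all distances are at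
  most 2, and a set is strong resolving iff its complement is a clique no two of whose vertices are
  twins (adjacent with equal closed neighbourhoods). Cliques are chains of cyclic subgroups; their
  maximal size is one more than the largest number of prime factors of an element order. If
  \<open>\<langle>x\<rangle> \<subset> \<langle>y\<rangle>\<close> are twins, then \<open>y\<^sup>-\<^sup>1\<close> cannot distinguish them, so \<open>y\<close> is an involution and \<open>x\<close> is the
  identity; moreover \<open>y\<close> then lies in every nontrivial cyclic subgroup. Hence twins exist exactly in
  the 2-groups with a unique involution, where they cost one vertex of the clique.

  These 2-groups are classified as follows. Let \<open>A = \<langle>a\<rangle>\<close> be a cyclic subgroup of maximal order
  \<open>2\<^sup>m \<ge> 4\<close>. An element \<open>b\<close> outside \<open>A\<close> that normalises \<open>A\<close> and has its square in \<open>A\<close> must invert \<open>A\<close>, since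
  otherwise some \<open>a\<^sup>ib\<close> would be a second involution; as \<open>-1\<close> is not a square modulo 4, every element of
  \<open>N(A) - A\<close> is of this kind and \<open>N(A)\<close> is \<open>A\<close> or generalized quaternion. If \<open>m \<ge> 3\<close>, then \<open>A\<close> is
  characteristic in \<open>N(A)\<close>, so \<open>N(A)\<close> is its own normaliser and thus the whole group; if \<open>m = 2\<close>, all
  squares lie in the subgroup of order 2, so \<open>A\<close> is normal.
\<close>

section \<open>Strong resolving sets in graphs with a universal vertex\<close>

text \<open>The walk \<open>q\<close> bounds the number of vertices of \<open>p\<close> by three,
  and \<open>p\<close> already contains the three distinct vertices \<open>z\<close>,
  \<open>y\<close>, \<open>x\<close>. So \<open>p\<close> is \<open>[z, y, x]\<close>, and its
  minimality rules out the arc \<open>(z, x)\<close>.\<close>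

lemma shortest_path_distance_two:
  assumes p: "shortest_path \<Gamma> z p x" "y \<in> set p"
    and q: "vpath q (with_proj \<Gamma>)" "hd q = z" "last q = x" "length q \<le> 3"
    and ne: "z \<noteq> x" "z \<noteq> y" "x \<noteq> y"
  shows "(z, y) \<in> parcs \<Gamma> \<and> (y, x) \<in> parcs \<Gamma> \<and> (z, x) \<notin> parcs \<Gamma>"
proof -
  have vp: "vpath p (with_proj \<Gamma>)" "hd p = z" "last p = x" "vwalk_length p \<le> vwalk_length q"
    using p q unfolding shortest_path_def by blast+
  have pne: "p \<noteq> []" "set p \<subseteq> pverts \<Gamma>" "set (vwalk_arcs p) \<subseteq> parcs \<Gamma>" "distinct p"
    using vp(1) by (auto simp: vpath_def vwalk_def arcs_ends_def arc_to_ends_def)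
  have "length p \<le> 3"
    using vp(4) q(4) by simp
  moreover have "{z, x, y} \<subseteq> set p" using vp(2,3) p(2) pne(1) by auto
  then have "3 \<le> length p"
    using ne card_mono[of "set p" "{z, x, y}"] card_length[of p] by simp
  ultimately have "length p = 3" by simp
  then obtain a b c where abc: "p = [a, b, c]"
    by (auto simp: numeral_3_eq_3 length_Suc_conv)
  then have pe: "p = [z, y, x]" using vp(2,3) p(2) ne by auto
  have "(z, x) \<notin> parcs \<Gamma>"
  proof
    assume "(z, x) \<in> parcs \<Gamma>"
    then have "vpath [z, x] (with_proj \<Gamma>)"
      using pne(2) pe ne by (auto simp: vpath_def vwalk_def arcs_ends_def arc_to_ends_def)
    moreover have "hd [z, x] = z" "last [z, x] = x" by simp_all
    ultimately have "vwalk_length p \<le> vwalk_length [z, x]"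
      using p(1) unfolding shortest_path_def by blast
    then show False using pe by simp
  qed
  then show ?thesis using pne(3) pe by simp
qed

definition universal_vertex :: "'a pair_pre_digraph \<Rightarrow> 'a \<Rightarrow> bool" where
  "universal_vertex \<Gamma> e \<longleftrightarrow>
     e \<in> pverts \<Gamma> \<and> (\<forall>x\<in>pverts \<Gamma>. x \<noteq> e \<longrightarrow> (e, x) \<in> parcs \<Gamma> \<and> (x, e) \<in> parcs \<Gamma>)"

text \<open>Distances are at most 2 because every pair is joined through \<open>e\<close>. A vertex
  \<open>z\<close> other than \<open>x\<close> and \<open>y\<close> can therefore resolve them only
  by a shortest path of length 2 whose middle vertex is one of the pair.\<close>

lemma strongly_resolves_iff:
  assumes "pair_graph \<Gamma>" and e: "universal_vertex \<Gamma> e"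
    and V: "x \<in> pverts \<Gamma>" "y \<in> pverts \<Gamma>" "z \<in> pverts \<Gamma>" "x \<noteq> y"
  shows "strongly_resolves \<Gamma> z x y \<longleftrightarrow>
    z = x \<or> z = y \<or>
    (x, y) \<in> parcs \<Gamma> \<and> ((z, x) \<in> parcs \<Gamma> \<longleftrightarrow> (z, y) \<notin> parcs \<Gamma>)"
proof -
  interpret pair_graph \<Gamma> by fact
  have inV: "u \<in> pverts \<Gamma>" "v \<in> pverts \<Gamma>" if "(u, v) \<in> parcs \<Gamma>" for u v
    using wellformed[OF that] by auto
  have sym: "(u, v) \<in> parcs \<Gamma> \<Longrightarrow> (v, u) \<in> parcs \<Gamma>" for u v
    using sym_arcs by (auto simp: symmetric_def sym_def)
  have short: "\<exists>q. vpath q (with_proj \<Gamma>) \<and> hd q = u \<and> last q = v \<and> length q \<le> 3"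
    if "u \<in> pverts \<Gamma>" "v \<in> pverts \<Gamma>" "u \<noteq> v" for u v
  proof (cases "u = e \<or> v = e")
    case True
    then show ?thesis using e that
      by (intro exI[of _ "[u, v]"])
        (auto simp: vpath_def vwalk_def arcs_ends_def arc_to_ends_def universal_vertex_def)
  next
    case False
    then show ?thesis using e that
      by (intro exI[of _ "[u, e, v]"])
        (auto simp: vpath_def vwalk_def arcs_ends_def arc_to_ends_def universal_vertex_def)
  qed
  \<comment> \<open>When \<open>z\<close> is itself one of the two vertices, it lies on every
    shortest path that starts there, so only the existence of a shortest path matters.\<close>
  have through: "\<exists>p. shortest_path \<Gamma> u p v \<and> u \<in> set p"
    if "u \<in> pverts \<Gamma>" "v \<in> pverts \<Gamma>" "u \<noteq> v" for u v
  proof -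
    let ?P = "\<lambda>q. vpath q (with_proj \<Gamma>) \<and> hd q = u \<and> last q = v"
    from short[OF that] obtain q0 where "?P q0" by auto
    then obtain q where "?P q" "\<forall>q'. ?P q' \<longrightarrow> vwalk_length q \<le> vwalk_length q'"
      using ex_has_least_nat[of ?P q0 vwalk_length] by blast
    then show ?thesis unfolding shortest_path_def
      by (intro exI[of _ q]) (auto simp: vpath_def vwalk_def)
  qed
  have two: "shortest_path \<Gamma> w [w, v, u] u"
    if "(w, v) \<in> parcs \<Gamma>" "(v, u) \<in> parcs \<Gamma>" "(w, u) \<notin> parcs \<Gamma>" "w \<noteq> u" for u v w
  proof -
    have "w \<noteq> v" "v \<noteq> u" using that by auto
    moreover have "2 \<le> vwalk_length q"
      if q: "vpath q (with_proj \<Gamma>)" "hd q = w" "last q = u" for q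
    proof (rule ccontr)
      assume "\<not> ?thesis"
      then have "length q \<le> 2" by simp
      then consider "q = []" | a where "q = [a]" | a b where "q = [a, b]"
        by (metis One_nat_def Suc_1 le_Suc_eq le_zero_eq length_0_conv length_Suc_conv)
      then show False
        using q \<open>(w, u) \<notin> parcs \<Gamma>\<close> \<open>w \<noteq> u\<close>
        by cases (auto simp: vpath_def vwalk_def arcs_ends_def arc_to_ends_def)
    qed
    moreover have "set [w, v, u] \<subseteq> pverts \<Gamma>" using inV that by auto
    moreover have "vwalk_length [w, v, u] = 2" by simp
    ultimately show ?thesis unfolding shortest_path_def using that
      by (auto simp: vpath_def vwalk_def arcs_ends_def arc_to_ends_def simp del: vwalk_length_simp)
  qed
  show ?thesis
  proof
    assume L: "strongly_resolves \<Gamma> z x y"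
    show "z = x \<or> z = y \<or>
      (x, y) \<in> parcs \<Gamma> \<and> ((z, x) \<in> parcs \<Gamma> \<longleftrightarrow> (z, y) \<notin> parcs \<Gamma>)"
    proof (rule ccontr)
      assume N: "\<not> ?thesis"
      then have "z \<noteq> x" "z \<noteq> y" by auto
      from short[OF V(3,1) \<open>z \<noteq> x\<close>] short[OF V(3,2) \<open>z \<noteq> y\<close>] obtain q q' where
        "vpath q (with_proj \<Gamma>)" "hd q = z" "last q = x" "length q \<le> 3"
        "vpath q' (with_proj \<Gamma>)" "hd q' = z" "last q' = y" "length q' \<le> 3" by blast
      note q = this
      from L consider p where "shortest_path \<Gamma> z p x" "y \<in> set p"
        | p where "shortest_path \<Gamma> z p y" "x \<in> set p"
        unfolding strongly_resolves_def by blast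
      then show False
      proof cases
        case (1 p)
        then show False
          using shortest_path_distance_two[OF 1 q(1-4)] N V(4) sym by blast
      next
        case (2 p)
        then show False
          using shortest_path_distance_two[OF 2 q(5-8)] N V(4) sym by blast
      qed
    qed
  next
    assume R: "z = x \<or> z = y \<or>
      (x, y) \<in> parcs \<Gamma> \<and> ((z, x) \<in> parcs \<Gamma> \<longleftrightarrow> (z, y) \<notin> parcs \<Gamma>)"
    consider "z = x" | "z = y" | "z \<noteq> x" "z \<noteq> y" by blast
    then show "strongly_resolves \<Gamma> z x y"
    proof cases
      case 1
      then show ?thesis using through V unfolding strongly_resolves_def by blast
    next
      case 2
      then show ?thesis using through V unfolding strongly_resolves_def by blast
    next
      case 3
      with R have "(x, y) \<in> parcs \<Gamma>" "(y, x) \<in> parcs \<Gamma>"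
        "(z, x) \<in> parcs \<Gamma> \<longleftrightarrow> (z, y) \<notin> parcs \<Gamma>" using sym by auto
      note R = this
      show ?thesis
      proof (cases "(z, x) \<in> parcs \<Gamma>")
        case True
        then have "shortest_path \<Gamma> z [z, x, y] y" using two R 3 by blast
        then show ?thesis unfolding strongly_resolves_def by fastforce
      next
        case False
        then have "shortest_path \<Gamma> z [z, y, x] x" using two R 3 by blast
        then show ?thesis unfolding strongly_resolves_def by fastforce
      qed
    qed
  qed
qed

text \<open>Adjacent vertices lie in each other's open neighbourhood but not in their own, so only
  the closed neighbourhoods of adjacent vertices can coincide.\<close>

definition closed_nbhd :: "'a pair_pre_digraph \<Rightarrow> 'a \<Rightarrow> 'a set" where
  "closed_nbhd \<Gamma> x = insert x {z. (z, x) \<in> parcs \<Gamma>}"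

definition twin_free_clique :: "'a pair_pre_digraph \<Rightarrow> 'a set \<Rightarrow> bool" where
  "twin_free_clique \<Gamma> T \<longleftrightarrow> T \<subseteq> pverts \<Gamma> \<and>
     (\<forall>x\<in>T. \<forall>y\<in>T. x \<noteq> y \<longrightarrow> (x, y) \<in> parcs \<Gamma> \<and> closed_nbhd \<Gamma> x \<noteq> closed_nbhd \<Gamma> y)"

text \<open>A pair that is not contained in \<open>T\<close> is resolved by its own member outside
  \<open>T\<close>. A pair inside \<open>T\<close> needs a third vertex adjacent to exactly one of
  the two, that is, a difference between the closed neighbourhoods of two adjacent vertices.\<close>

lemma strong_resolving_set_iff_twin_free:
  assumes "pair_graph \<Gamma>" and e: "universal_vertex \<Gamma> e" and T: "T \<subseteq> pverts \<Gamma>"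
  shows "strong_resolving_set \<Gamma> (pverts \<Gamma> - T) \<longleftrightarrow> twin_free_clique \<Gamma> T"
proof -
  interpret pair_graph \<Gamma> by fact
  note res = strongly_resolves_iff[OF assms(1) e]
  have inV: "u \<in> pverts \<Gamma>" "v \<in> pverts \<Gamma>" if "(u, v) \<in> parcs \<Gamma>" for u v
    using wellformed[OF that] by auto
  have sym: "(u, v) \<in> parcs \<Gamma> \<Longrightarrow> (v, u) \<in> parcs \<Gamma>" for u v
    using sym_arcs by (auto simp: symmetric_def sym_def)
  have irr: "(u, u) \<notin> parcs \<Gamma>" for u using no_loops[of "(u, u)"] by auto
  show ?thesis
  proof
    assume S: "strong_resolving_set \<Gamma> (pverts \<Gamma> - T)"
    have "(x, y) \<in> parcs \<Gamma> \<and> closed_nbhd \<Gamma> x \<noteq> closed_nbhd \<Gamma> y"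
      if xy: "x \<in> T" "y \<in> T" "x \<noteq> y" for x y
    proof -
      have "x \<in> pverts \<Gamma>" "y \<in> pverts \<Gamma>" using xy T by auto
      then obtain z where z: "z \<in> pverts \<Gamma>" "z \<notin> T" "strongly_resolves \<Gamma> z x y"
        using S xy unfolding strong_resolving_set_def by blast
      then have "(x, y) \<in> parcs \<Gamma> \<and> ((z, x) \<in> parcs \<Gamma> \<longleftrightarrow> (z, y) \<notin> parcs \<Gamma>)"
        using res[of x y z] xy \<open>x \<in> pverts \<Gamma>\<close> \<open>y \<in> pverts \<Gamma>\<close> by auto
      moreover have "z \<noteq> x" "z \<noteq> y" using z xy by auto
      ultimately show ?thesis unfolding closed_nbhd_def by auto
    qed
    then show "twin_free_clique \<Gamma> T" using T unfolding twin_free_clique_def by blast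
  next
    assume C: "twin_free_clique \<Gamma> T"
    have "\<exists>z\<in>pverts \<Gamma> - T. strongly_resolves \<Gamma> z x y"
      if xy: "x \<in> pverts \<Gamma>" "y \<in> pverts \<Gamma>" "x \<noteq> y" for x y
    proof (cases "x \<in> T \<and> y \<in> T")
      case False
      then show ?thesis using res[OF xy(1,2) _ xy(3)] xy by auto
    next
      case True
      then have adj: "(x, y) \<in> parcs \<Gamma>" and N: "closed_nbhd \<Gamma> x \<noteq> closed_nbhd \<Gamma> y"
        using C xy unfolding twin_free_clique_def by auto
      obtain z where "z \<in> closed_nbhd \<Gamma> x \<longleftrightarrow> z \<notin> closed_nbhd \<Gamma> y"
        using N by blast
      moreover have "x \<in> closed_nbhd \<Gamma> y" "y \<in> closed_nbhd \<Gamma> x"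
        "x \<in> closed_nbhd \<Gamma> x" "y \<in> closed_nbhd \<Gamma> y"
        using adj sym by (auto simp: closed_nbhd_def)
      ultimately have z: "z \<noteq> x" "z \<noteq> y" "(z, x) \<in> parcs \<Gamma> \<longleftrightarrow> (z, y) \<notin> parcs \<Gamma>"
        unfolding closed_nbhd_def by auto
      \<comment> \<open>All other members of the clique \<open>T\<close> are adjacent to both
        \<open>x\<close> and \<open>y\<close>, whereas \<open>z\<close> is adjacent to exactly one
        of them.\<close>
      then have "z \<notin> T" using C True unfolding twin_free_clique_def by blast
      moreover have "z \<in> pverts \<Gamma>" using z inV by blast
      ultimately show ?thesis using res[OF xy(1,2) _ xy(3), of z] z adj by blast
    qed
    then show "strong_resolving_set \<Gamma> (pverts \<Gamma> - T)"
      unfolding strong_resolving_set_def by auto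
  qed
qed

text \<open>Complementation exchanges smallest strong resolving sets and largest twin-free cliques.
  The integer form avoids truncated subtraction.\<close>

lemma sdim_eq_twin_free:
  assumes G: "pair_graph \<Gamma>" and e: "universal_vertex \<Gamma> e"
    and T: "twin_free_clique \<Gamma> T" "card T = m"
    and max: "\<And>T'. twin_free_clique \<Gamma> T' \<Longrightarrow> card T' \<le> m"
  shows "int (sdim \<Gamma>) = int (card (pverts \<Gamma>)) - int m"
proof -
  interpret pair_graph \<Gamma> by fact
  note fin = pair_finite_verts
  have TV: "T \<subseteq> pverts \<Gamma>" using T(1) by (simp add: twin_free_clique_def)
  note iff = strong_resolving_set_iff_twin_free[OF G e]
  have "sdim \<Gamma> = card (pverts \<Gamma>) - m"
    unfolding sdim_def
  proof (rule Least_equality)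
    show "\<exists>S. finite S \<and> strong_resolving_set \<Gamma> S \<and> card S = card (pverts \<Gamma>) - m"
      using iff[OF TV] T fin TV
      by (intro exI[of _ "pverts \<Gamma> - T"]) (simp add: card_Diff_subset finite_subset)
  next
    fix k assume "\<exists>S. finite S \<and> strong_resolving_set \<Gamma> S \<and> card S = k"
    then obtain S where S: "finite S" "strong_resolving_set \<Gamma> S" "card S = k" by blast
    then have SV: "S \<subseteq> pverts \<Gamma>" by (simp add: strong_resolving_set_def)
    then have "pverts \<Gamma> - (pverts \<Gamma> - S) = S" by auto
    then have "twin_free_clique \<Gamma> (pverts \<Gamma> - S)"
      using iff[of "pverts \<Gamma> - S"] S(2) by simp
    from max[OF this] show "card (pverts \<Gamma>) - m \<le> k"
      using S SV by (simp add: card_Diff_subset)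
  qed
  moreover have "m \<le> card (pverts \<Gamma>)" using T(2) TV fin card_mono by blast
  ultimately show ?thesis by simp
qed

section \<open>Twins and cliques in the reduced power graph\<close>

lemma num_prime_factors_mono_strict:
  assumes "a dvd b" "a \<noteq> b" "b > 0"
  shows "num_prime_factors a < num_prime_factors b"
proof -
  have "a > 0" using assms by (auto intro: Nat.gr0I)
  have "prime_factorization a \<subset># prime_factorization b"
    using assms \<open>a > 0\<close> prime_factorization_subset_iff_dvd[of a b]
      prime_factorization_eqI_strong by (metis neq0_conv prod_mset_prime_factorization_nat subset_mset.le_neq_trans)
  then show ?thesis unfolding num_prime_factors_def by (rule mset_subset_size)
qed

lemma num_prime_factors_1 [simp]: "num_prime_factors (Suc 0) = 0"
  by (simp add: num_prime_factors_def)

lemma num_prime_factors_eq_1: "num_prime_factors m = 1 \<Longrightarrow> prime m"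
proof -
  assume 1: "num_prime_factors m = 1"
  then have "m > 0" by (auto simp: num_prime_factors_def intro: Nat.gr0I)
  from 1 obtain p where p: "prime_factorization m = {#p#}"
    unfolding num_prime_factors_def using size_1_singleton_mset by blast
  then have "prime p" using in_prime_factors_imp_prime[of p m] by simp
  moreover have "m = p" using p \<open>m > 0\<close> prod_mset_prime_factorization_nat[of m] by simp
  ultimately show "prime m" by simp
qed

lemma num_prime_factors_times_prime:
  assumes "prime p" "m > 0" shows "num_prime_factors (p * m) = Suc (num_prime_factors m)"
  using assms by (simp add: num_prime_factors_def prime_factorization_mult prime_factorization_prime)

lemma num_prime_factors_prime_power:
  assumes "prime p" shows "num_prime_factors (p ^ k) = k"
  using assms by (simp add: num_prime_factors_def prime_factorization_prime_power)

section \<open>Cyclic subgroups of a finite group and adjacency\<close>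

locale finite_group = group G for G (structure) +
  assumes finite_carrier: "finite (carrier G)"
begin

abbreviation cyc :: "'a \<Rightarrow> 'a set" where "cyc x \<equiv> generate G {x}"

abbreviation PR :: "'a pair_pre_digraph" where "PR \<equiv> reduced_power_graph G"

lemma cyc_self: "x \<in> cyc x" by (rule generate.incl) simp

lemma cyc_carrier: "x \<in> carrier G \<Longrightarrow> cyc x \<subseteq> carrier G"
  by (rule generate_incl) simp

lemma cyc_mono: "x \<in> carrier G \<Longrightarrow> y \<in> cyc x \<Longrightarrow> cyc y \<subseteq> cyc x"
  by (rule generate_subgroup_incl) (auto intro: generate_is_subgroup)

lemma cyc_eq: "x \<in> carrier G \<Longrightarrow> cyc x = {x [^] k | k. k \<in> (UNIV :: nat set)}"
  using generate_pow_on_finite_carrier[OF finite_carrier] .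

lemma cyc_pow: "x \<in> carrier G \<Longrightarrow> x [^] (k::nat) \<in> cyc x"
  by (auto simp: cyc_eq)

lemma ord_pos: "x \<in> carrier G \<Longrightarrow> ord x > 0"
  using ord_ge_1[OF finite_carrier] by force

lemma cyc_one: "cyc \<one> = {\<one>}" by (rule generate_one)

lemma one_in_cyc: "\<one> \<in> cyc x" by (rule generate.one)

lemma ord_dvd_of_cyc: "x \<in> carrier G \<Longrightarrow> y \<in> cyc x \<Longrightarrow> ord y dvd ord x"
  by (auto simp: cyc_eq pow_eq_id[symmetric] nat_pow_pow)
     (metis mult.commute nat_pow_closed nat_pow_one nat_pow_pow pow_ord_eq_1)

text \<open>The number of prime factors of the order serves as a strictly monotone rank on cyclic
  subgroups; it bounds the length of chains.\<close>

lemma num_prime_factors_cyc_less: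
  assumes "x \<in> carrier G" "y \<in> carrier G" "cyc y \<subset> cyc x"
  shows "num_prime_factors (ord y) < num_prime_factors (ord x)"
proof (rule num_prime_factors_mono_strict)
  show "ord y dvd ord x" using assms ord_dvd_of_cyc cyc_self by blast
  have "finite (cyc x)" using cyc_carrier finite_carrier assms finite_subset by blast
  then have "card (cyc y) < card (cyc x)" using assms(3) by (rule psubset_card_mono)
  then show "ord y \<noteq> ord x" using generate_pow_card assms by auto
  show "ord x > 0" using ord_pos assms by simp
qed

lemma adjacent_iff:
  "(x, y) \<in> parcs PR \<longleftrightarrow> x \<in> carrier G \<and> y \<in> carrier G \<and> (cyc x \<subset> cyc y \<or> cyc y \<subset> cyc x)"
  by (auto simp: reduced_power_graph_def)

lemma pverts_PR [simp]: "pverts PR = carrier G"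
  by (simp add: reduced_power_graph_def)

lemma universal_vertex_one: "universal_vertex PR \<one>"
proof -
  have "cyc \<one> \<subset> cyc x" if "x \<in> carrier G" "x \<noteq> \<one>" for x
    using that cyc_self[of x] one_in_cyc[of x] by (auto simp: cyc_one)
  then show ?thesis unfolding universal_vertex_def adjacent_iff by auto
qed

text \<open>These elements are exactly the twins of the identity, by \<open>twins_dominating\<close>
  and \<open>dominating_twin\<close>.\<close>

definition dominating :: "'a \<Rightarrow> bool" where
  "dominating y \<longleftrightarrow> y \<in> carrier G \<and> ord y = 2 \<and> (\<forall>x\<in>carrier G. x \<noteq> \<one> \<longrightarrow> y \<in> cyc x)"

section \<open>Clique sizes and chains of cyclic subgroups\<close>

definition max_Omega :: nat where
  "max_Omega = Max {num_prime_factors m | m. m \<in> element_orders G}"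

lemma Omega_set: "{num_prime_factors m | m. m \<in> element_orders G} = (\<lambda>x. num_prime_factors (ord x)) ` carrier G"
  by (auto simp: element_orders_def)

lemma Omega_le: "x \<in> carrier G \<Longrightarrow> num_prime_factors (ord x) \<le> max_Omega"
  unfolding max_Omega_def Omega_set using finite_carrier by (intro Max_ge) auto

lemma Omega_max: obtains g where "g \<in> carrier G" "num_prime_factors (ord g) = max_Omega"
proof -
  have "max_Omega \<in> (\<lambda>x. num_prime_factors (ord x)) ` carrier G"
    unfolding max_Omega_def Omega_set using finite_carrier one_closed by (intro Max_in) auto
  then show ?thesis using that by auto
qed

text \<open>Adjacent vertices generate strictly nested subgroups, so their ranks differ. A clique
  thus has at most one vertex for each rank from 0 to \<open>max_Omega\<close>.\<close>

lemma clique_inj: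
  assumes "T \<subseteq> carrier G" "\<And>x y. x \<in> T \<Longrightarrow> y \<in> T \<Longrightarrow> x \<noteq> y \<Longrightarrow> (x, y) \<in> parcs PR"
  shows "inj_on (\<lambda>x. num_prime_factors (ord x)) T"
proof (rule inj_onI, rule ccontr)
  fix x y assume "x \<in> T" "y \<in> T" "num_prime_factors (ord x) = num_prime_factors (ord y)" "x \<noteq> y"
  with assms(2)[of x y] num_prime_factors_cyc_less[of x y] num_prime_factors_cyc_less[of y x]
  show False by (auto simp: adjacent_iff)
qed

lemma clique_card_le:
  assumes "T \<subseteq> carrier G" "\<And>x y. x \<in> T \<Longrightarrow> y \<in> T \<Longrightarrow> x \<noteq> y \<Longrightarrow> (x, y) \<in> parcs PR"
  shows "card T \<le> Suc max_Omega"
proof -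
  have "card T \<le> card {..max_Omega}"
    using clique_inj[OF assms] assms(1) Omega_le by (intro card_inj_on_le) auto
  then show ?thesis by simp
qed

text \<open>Induction on the order: for a prime \<open>p\<close> dividing \<open>ord g\<close>, the
  power \<open>g [^] p\<close> generates a proper subgroup with one prime factor fewer, and
  \<open>g\<close> extends a chain found there. The identity is tracked because
  \<open>sdim_dominating\<close> removes it from the chain.\<close>

lemma chain_clique:
  assumes "g \<in> carrier G"
  shows "\<exists>T \<subseteq> cyc g. \<one> \<in> T \<and> card T = Suc (num_prime_factors (ord g)) \<and>
    (\<forall>x\<in>T. \<forall>y\<in>T. x \<noteq> y \<longrightarrow> (x, y) \<in> parcs PR)"
  using assms
proof (induction "ord g" arbitrary: g rule: less_induct)
  case less
  show ?case
  proof (cases "g = \<one>")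
    case True
    then show ?thesis by (intro exI[of _ "{\<one>}"]) (auto simp: cyc_one)
  next
    case False
    then have "ord g \<noteq> 1" using ord_eq_1 less by blast
    then obtain p where p: "prime p" "p dvd ord g" using prime_factor_nat by blast
    then obtain m where m: "ord g = p * m" by blast
    have "m > 0" using m ord_pos[OF less(2)] by (auto intro: Nat.gr0I)
    define h where "h = g [^] p"
    have h: "h \<in> carrier G" "h \<in> cyc g" using less(2) cyc_pow by (auto simp: h_def)
    have "p > 0" using p(1) prime_gt_0_nat by blast
    then have oh: "ord h = m" unfolding h_def using ord_pow[OF less(2) p(2)] m by simp
    have "m < ord g" using m \<open>m > 0\<close> prime_gt_1_nat[OF p(1)] by simp
    with less(1)[of h] oh h obtain T where T: "T \<subseteq> cyc h" "\<one> \<in> T"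
      "card T = Suc (num_prime_factors m)" "\<forall>x\<in>T. \<forall>y\<in>T. x \<noteq> y \<longrightarrow> (x, y) \<in> parcs PR" by auto
    have Tc: "T \<subseteq> carrier G" using T(1) cyc_carrier h by blast
    have sub: "cyc h \<subseteq> cyc g" using cyc_mono[OF less(2) h(2)] .
    have "card (cyc h) < card (cyc g)"
      using generate_pow_card[OF h(1)] generate_pow_card[OF less(2)] oh \<open>m < ord g\<close> by simp
    then have psub: "cyc h \<subset> cyc g" using sub by auto
    have small: "cyc x \<subset> cyc g" if "x \<in> T" for x
      using that T(1) cyc_mono[OF h(1)] psub by blast
    have "g \<notin> T" using small by blast
    moreover have "finite T" using Tc finite_carrier finite_subset by blast
    ultimately have "card (insert g T) = Suc (num_prime_factors (ord g))"
      using T(3) m num_prime_factors_times_prime[OF p(1) \<open>m > 0\<close>] by simp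
    moreover have "insert g T \<subseteq> cyc g" using T(1) sub cyc_self by blast
    moreover have "\<forall>x\<in>insert g T. \<forall>y\<in>insert g T. x \<noteq> y \<longrightarrow> (x, y) \<in> parcs PR"
      using T(4) small less(2) Tc by (auto simp: adjacent_iff)
    ultimately show ?thesis using T(2) by blast
  qed
qed

section \<open>Twins\<close>

lemma twins_cyc:
  assumes x: "x \<in> carrier G" and y: "y \<in> carrier G" and less: "cyc x \<subset> cyc y"
    and N: "closed_nbhd PR x = closed_nbhd PR y"
  shows "x = \<one> \<and> dominating y"
proof -
  have same: "cyc (inv y) = cyc y"
  proof -
    have "inv y \<in> cyc y" by (rule generate.inv) simp
    moreover have "y \<in> cyc (inv y)" using generate.inv[of "inv y" "{inv y}" G] y by simp
    ultimately show ?thesis using cyc_mono y by (meson inv_closed subset_antisym)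
  qed
  have "inv y = y"
  proof (rule ccontr)
    assume ne: "inv y \<noteq> y"
    \<comment> \<open>As a generator of \<open>cyc y\<close>, the inverse is adjacent to
      \<open>x\<close>; but two generators of one cyclic subgroup are never adjacent.\<close>
    have "(inv y, x) \<in> parcs PR" using less same x y by (auto simp: adjacent_iff)
    then have "inv y \<in> closed_nbhd PR y" using N by (auto simp: closed_nbhd_def)
    then have "(inv y, y) \<in> parcs PR" using ne by (simp add: closed_nbhd_def)
    then show False using same by (auto simp: adjacent_iff)
  qed
  then have "y [^] (2::nat) = \<one>" using y by (metis nat_pow_Suc nat_pow_0 l_one numeral_2_eq_2 r_inv)
  then have "ord y dvd 2" using y pow_eq_id by simp
  moreover have "y \<noteq> \<one>" using less one_in_cyc[of x] by (auto simp: cyc_one)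
  then have "ord y \<noteq> 1" using y ord_eq_1 by blast
  ultimately have o: "ord y = 2" using prime_nat_iff two_is_prime_nat by blast
  have c2: "card (cyc y) = 2" using generate_pow_card[OF y] o by simp
  have "card (cyc x) < card (cyc y)" using less c2 by (intro psubset_card_mono) (auto intro: card_ge_0_finite)
  moreover have "card (cyc x) \<noteq> 0" using generate_pow_card[OF x] ord_pos[OF x] by simp
  ultimately have "ord x = 1" using generate_pow_card[OF x] c2 by simp
  then have x1: "x = \<one>" using ord_eq_1 x by blast
  have "y \<in> cyc z" if z: "z \<in> carrier G" "z \<noteq> \<one>" for z
  proof (cases "z = y")
    case False
    \<comment> \<open>The identity \<open>x\<close> is universal, hence so is its twin
      \<open>y\<close>. Only the trivial subgroup lies strictly inside \<open>cyc y\<close>, so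
      \<open>cyc y\<close> lies inside \<open>cyc z\<close>.\<close>
    have "(z, x) \<in> parcs PR" using universal_vertex_one z x1 by (auto simp: universal_vertex_def)
    then have "(z, y) \<in> parcs PR" using N False by (auto simp: closed_nbhd_def)
    then consider "cyc z \<subset> cyc y" | "cyc y \<subset> cyc z" by (auto simp: adjacent_iff)
    then show ?thesis
    proof cases
      case 1
      then have "card (cyc z) < 2" using c2 by (metis card_gt_0_iff psubset_card_mono zero_less_numeral)
      then have "ord z = 1" using generate_pow_card[OF z(1)] ord_pos[OF z(1)] by simp
      then show ?thesis using z ord_eq_1 by blast
    next
      case 2
      then show ?thesis using cyc_self by blast
    qed
  qed (simp add: cyc_self)
  then show ?thesis using x1 o y by (auto simp: dominating_def)
qed

lemma twins_dominating:
  assumes "(x, y) \<in> parcs PR" "closed_nbhd PR x = closed_nbhd PR y"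
  shows "x = \<one> \<and> dominating y \<or> y = \<one> \<and> dominating x"
  using assms twins_cyc[of x y] twins_cyc[of y x] by (auto simp: adjacent_iff)

text \<open>Both closed neighbourhoods are the whole group: an element other than \<open>y\<close>
  and the identity cannot generate \<open>cyc y\<close>, since that subgroup has only two
  elements.\<close>

lemma dominating_twin:
  assumes "dominating y" shows "closed_nbhd PR \<one> = closed_nbhd PR y"
proof -
  have y: "y \<in> carrier G" "ord y = 2" using assms by (auto simp: dominating_def)
  have "y \<noteq> \<one>" using y by auto
  have "(z, y) \<in> parcs PR" if z: "z \<in> carrier G" "z \<noteq> y" for z
  proof (cases "z = \<one>")
    case True
    then show ?thesis using universal_vertex_one y \<open>y \<noteq> \<one>\<close> by (auto simp: universal_vertex_def)
  next
    case False
    then have "y \<in> cyc z" using assms z by (auto simp: dominating_def)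
    then have sub: "cyc y \<subseteq> cyc z" using cyc_mono z by blast
    have "cyc y \<noteq> cyc z"
    proof
      assume e: "cyc y = cyc z"
      have "card (cyc y) = 2" using generate_pow_card[OF y(1)] y(2) by simp
      moreover have "{\<one>, y, z} \<subseteq> cyc y" using e cyc_self one_in_cyc by auto
      moreover have "card {\<one>, y, z} = 3" using False \<open>y \<noteq> \<one>\<close> z by simp
      ultimately show False using card_mono[of "cyc y" "{\<one>, y, z}"] card_ge_0_finite[of "cyc y"] by simp
    qed
    then show ?thesis using sub y z by (auto simp: adjacent_iff)
  qed
  then have "closed_nbhd PR y = carrier G"
    using y by (auto simp: closed_nbhd_def adjacent_iff)
  moreover have "closed_nbhd PR \<one> = carrier G"
    using universal_vertex_one by (auto simp: closed_nbhd_def adjacent_iff universal_vertex_def)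
  ultimately show ?thesis by simp
qed

section \<open>The dimension without and with a dominating involution\<close>

lemma pair_graph_PR: "pair_graph PR"
  using pair_graph_reduced_power_graph finite_carrier by blast

lemma sdim_not_dominating:
  assumes "\<And>y. \<not> dominating y"
  shows "int (sdim PR) = int (order G) - int max_Omega - 1"
proof -
  obtain g where g: "g \<in> carrier G" "num_prime_factors (ord g) = max_Omega" by (rule Omega_max)
  from chain_clique[OF g(1)] obtain T where T: "T \<subseteq> cyc g" "card T = Suc max_Omega"
    "\<forall>x\<in>T. \<forall>y\<in>T. x \<noteq> y \<longrightarrow> (x, y) \<in> parcs PR" using g(2) by auto
  have "twin_free_clique PR T"
    using T twins_dominating assms cyc_carrier[OF g(1)] unfolding twin_free_clique_def
    by (metis order_trans pverts_PR)
  then have "int (sdim PR) = int (card (pverts PR)) - int (Suc max_Omega)"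
    by (rule sdim_eq_twin_free[OF pair_graph_PR universal_vertex_one _ T(2)])
      (auto simp: twin_free_clique_def intro!: clique_card_le)
  then show ?thesis by (simp add: order_def)
qed

text \<open>A longest chain loses its only possible twins once the identity is removed. Conversely
  every twin-free clique misses a rank: rank 0 if it omits the identity, and otherwise rank 1,
  because an element of prime order whose cyclic subgroup contains \<open>y\<close> is
  \<open>y\<close> itself, a twin of the identity.\<close>

lemma sdim_dominating:
  assumes d: "dominating y"
  shows "int (sdim PR) = int (order G) - int max_Omega"
proof -
  have y: "y \<in> carrier G" "ord y = 2" using d by (auto simp: dominating_def)
  obtain g where g: "g \<in> carrier G" "num_prime_factors (ord g) = max_Omega" by (rule Omega_max)
  from chain_clique[OF g(1)] obtain T where T: "T \<subseteq> cyc g" "card T = Suc max_Omega" "\<one> \<in> T"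
    "\<forall>x\<in>T. \<forall>y\<in>T. x \<noteq> y \<longrightarrow> (x, y) \<in> parcs PR" using g(2) by auto
  have tf: "twin_free_clique PR (T - {\<one>})"
    using T twins_dominating cyc_carrier[OF g(1)] unfolding twin_free_clique_def
    by (metis Diff_iff Diff_subset insertI1 order_trans pverts_PR)
  have "card T' \<le> max_Omega" if T': "twin_free_clique PR T'" for T'
  proof -
    let ?f = "\<lambda>x. num_prime_factors (ord x)"
    have T'c: "T' \<subseteq> carrier G" using T' by (simp add: twin_free_clique_def)
    have inj: "inj_on ?f T'" using T' by (intro clique_inj) (auto simp: twin_free_clique_def)
    have "\<exists>j\<in>{..max_Omega}. j \<notin> ?f ` T'"
    proof (cases "\<one> \<in> T'")
      case False
      have "0 \<notin> ?f ` T'"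
      proof
        assume "0 \<in> ?f ` T'"
        then obtain x where "x \<in> T'" "num_prime_factors (ord x) = 0" by auto
        moreover have "x \<in> carrier G" "x \<noteq> \<one>" using \<open>x \<in> T'\<close> T'c False by auto
        then have "1 \<noteq> ord x" "ord x > 0" using ord_eq_1 ord_pos by fastforce+
        then have "num_prime_factors 1 < num_prime_factors (ord x)"
          by (rule num_prime_factors_mono_strict[OF one_dvd])
        ultimately show False by simp
      qed
      then show ?thesis by blast
    next
      case True
      have "1 \<notin> ?f ` T'"
      proof
        assume "1 \<in> ?f ` T'"
        then obtain x where x: "x \<in> T'" "num_prime_factors (ord x) = 1" by auto
        have pr: "prime (ord x)" using x(2) by (rule num_prime_factors_eq_1)
        have xc: "x \<in> carrier G" using x T'c by auto
        have "x \<noteq> \<one>" using pr by auto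
        then have yx: "y \<in> cyc x" using d xc by (auto simp: dominating_def)
        then have "2 dvd ord x" using ord_dvd_of_cyc[OF xc yx] y(2) by simp
        then have o: "ord x = 2" using pr primes_dvd_imp_eq two_is_prime_nat by metis
        have "{\<one>, x} = cyc x"
        proof (rule card_subset_eq)
          show "finite (cyc x)" using cyc_carrier xc finite_carrier finite_subset by blast
          show "card {\<one>, x} = card (cyc x)" using generate_pow_card[OF xc] o \<open>x \<noteq> \<one>\<close> by simp
        qed (use one_in_cyc cyc_self in auto)
        then have "y \<in> {\<one>, x}" using yx by simp
        moreover have "y \<noteq> \<one>" using y by auto
        ultimately have "y = x" by simp
        then have "closed_nbhd PR \<one> = closed_nbhd PR x" using dominating_twin d by blast
        then show False using T' x True \<open>x \<noteq> \<one>\<close> unfolding twin_free_clique_def by metis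
      qed
      \<comment> \<open>The missing rank 1 only counts if it is among the available ranks, which the
        element \<open>y\<close> of order 2 ensures.\<close>
      moreover have "1 \<le> max_Omega"
        using Omega_le[OF y(1)] y(2) num_prime_factors_prime_power[of 2 1] by simp
      ultimately show ?thesis by auto
    qed
    then obtain j where j: "j \<le> max_Omega" "j \<notin> ?f ` T'" by blast
    have "?f ` T' \<subseteq> {..max_Omega}" using Omega_le T'c by blast
    with j have "?f ` T' \<subseteq> {..max_Omega} - {j}" by blast
    then have "card T' \<le> card ({..max_Omega} - {j})"
      using inj card_inj_on_le by blast
    also have "\<dots> = max_Omega" using j by simp
    finally show ?thesis .
  qed
  moreover have "card (T - {\<one>}) = max_Omega" using T by simp
  ultimately have "int (sdim PR) = int (card (pverts PR)) - int max_Omega"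
    using sdim_eq_twin_free[OF pair_graph_PR universal_vertex_one tf] by blast
  then show ?thesis by (simp add: order_def)
qed

end

section \<open>Two-groups and their normalisers\<close>

lemma two_power_coprime_odd: "odd (q::int) \<Longrightarrow> coprime (2 ^ m) q"
  by simp

text \<open>
  With \<open>b\<^sup>2 = a\<^sup>s\<close> and \<open>b\<^sup>-\<^sup>1ab = a\<^sup>r\<close>, the first hypothesis says that no \<open>a\<^sup>ib\<close> is an involution
  or trivial, the second that \<open>b\<close> centralises \<open>b\<^sup>2\<close>.
\<close>
lemma two_adic_inverting:
  fixes r s :: int
  assumes no_root: "\<And>i. \<not> 2 ^ m dvd s + i * (r + 1)" and fixed: "2 ^ m dvd s * (r - 1)"
    and "even s"
  shows "2 ^ m dvd r + 1" "2 ^ (m - 1) dvd s" "\<not> 2 ^ m dvd s"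
proof -
  show s0: "\<not> 2 ^ m dvd s" using no_root[of 0] by simp
  then have "s \<noteq> 0" by auto
  moreover have nu: "\<not> is_unit (2::int)" by simp
  ultimately obtain s' where s': "s = 2 ^ multiplicity 2 s * s'" "odd s'"
    using multiplicity_decompose'[of s 2] by blast
  define v where "v = multiplicity 2 s"
  have s: "s = 2 ^ v * s'" using s'(1) v_def by simp
  \<comment> \<open>This is where \<open>even s\<close> enters; it later makes
    \<open>2 ^ v * q - 1\<close> odd.\<close>
  have "v \<noteq> 0" using s s'(2) \<open>even s\<close> by (cases v) auto
  have "v < m"
  proof (rule ccontr)
    assume "\<not> v < m"
    then have "(2::int) ^ m dvd 2 ^ v" by (simp add: le_imp_power_dvd)
    then show False using s0 s by simp
  qed
  \<comment> \<open>If the valuation of \<open>r + 1\<close> were at most that of \<open>s\<close>,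
    then \<open>i * (r + 1)\<close> could be made congruent to \<open>- s\<close> modulo
    \<open>2 ^ m\<close>, against \<open>no_root\<close>.\<close>
  have r1: "2 ^ Suc v dvd r + 1"
  proof (rule ccontr)
    assume nd: "\<not> ?thesis"
    then have "r + 1 \<noteq> 0" by auto
    then obtain w' where w': "r + 1 = 2 ^ multiplicity 2 (r + 1) * w'" "odd w'"
      using multiplicity_decompose'[of "r + 1" 2] nu by blast
    define w where "w = multiplicity 2 (r + 1)"
    have w: "r + 1 = 2 ^ w * w'" using w'(1) w_def by simp
    have "w \<le> v"
    proof (rule ccontr)
      assume "\<not> w \<le> v"
      then have "(2::int) ^ Suc v dvd 2 ^ w" by (intro le_imp_power_dvd) simp
      then show False using nd w by simp
    qed
    have "gcd w' (2 ^ m) = 1" using w'(2) by (simp flip: coprime_iff_gcd_eq_1)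
    then obtain k l where kl: "k * w' + l * 2 ^ m = 1" using bezout_int[of w' "2 ^ m"] by auto
    \<comment> \<open>Here \<open>k\<close> inverts the odd part \<open>w'\<close> of
      \<open>r + 1\<close> modulo \<open>2 ^ m\<close>, so this \<open>i\<close> solves the
      congruence.\<close>
    define i where "i = - (2 ^ (v - w) * s' * k)"
    have "i * (r + 1) = - (2 ^ (v - w) * 2 ^ w * s' * (k * w'))" by (simp add: i_def w)
    also have "\<dots> = - (2 ^ v * s' * (1 - l * 2 ^ m))"
      using \<open>w \<le> v\<close> eq_diff_eq[THEN iffD2, OF kl] by (simp flip: power_add)
    finally have "s + i * (r + 1) = 2 ^ m * (2 ^ v * s' * l)" by (simp add: s algebra_simps)
    then show False using no_root by (metis dvd_triv_left)
  qed
  then obtain q where q: "r + 1 = 2 ^ Suc v * q" by blast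
  \<comment> \<open>Since 4 divides \<open>r + 1\<close>, the number \<open>r - 1\<close> is twice
    an odd number. Then \<open>s * (r - 1)\<close> has valuation exactly \<open>Suc v\<close>, and
    \<open>fixed\<close> yields \<open>m \<le> Suc v\<close>.\<close>
  have "odd (2 ^ v * q - 1)" using \<open>v \<noteq> 0\<close> by simp
  then have o: "odd (s' * (2 ^ v * q - 1))" using s'(2) by simp
  have "s * (r - 1) = 2 ^ Suc v * (s' * (2 ^ v * q - 1))"
  proof -
    have "r - 1 = 2 * (2 ^ v * q - 1)" using q by simp
    then show ?thesis by (simp add: s)
  qed
  then have "2 ^ m dvd 2 ^ Suc v * (s' * (2 ^ v * q - 1))" using fixed by simp
  then have "2 ^ m dvd (2::int) ^ Suc v"
    using two_power_coprime_odd[OF o] coprime_dvd_mult_left_iff by blast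
  then have "(2::int) ^ m \<le> 2 ^ Suc v" by (rule zdvd_imp_le) simp
  then have "m \<le> Suc v" by (simp only: power_increasing_iff one_less_numeral_iff semiring_norm)
  with \<open>v < m\<close> have m: "m = Suc v" by simp
  show "2 ^ m dvd r + 1" using r1 m by simp
  show "2 ^ (m - 1) dvd s" using s m by simp
qed

context finite_group begin

lemma order_subgroup_pow:
  assumes "subgroup H G" "x \<in> H" shows "x [^] card H = \<one>"
proof -
  interpret H: group "G\<lparr>carrier := H\<rparr>" using assms subgroup_imp_group by blast
  have "x [^]\<^bsub>G\<lparr>carrier := H\<rparr>\<^esub> order (G\<lparr>carrier := H\<rparr>) = \<one>"
    using H.pow_order_eq_1[of x] assms(2) by simp
  then show ?thesis using nat_pow_consistent[of x] by (simp add: order_def)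
qed

text \<open>For a prime \<open>p\<close> dividing the order, a Sylow \<open>p\<close>-subgroup
  contains some \<open>x\<close> other than the identity. The involution \<open>z\<close> lies in
  \<open>cyc x\<close>, so 2 divides a power of \<open>p\<close>.\<close>

lemma dominating_two_group:
  assumes "dominating z" obtains N where "order G = 2 ^ N"
proof -
  have z: "z \<in> carrier G" "ord z = 2" using assms by (auto simp: dominating_def)
  have pos: "order G > 0" using finite_carrier order_gt_0_iff_finite by simp
  have two: "p = 2" if p: "prime p" "p dvd order G" for p
  proof -
    obtain m where m: "order G = p ^ multiplicity p (order G) * m"
      using multiplicity_decompose'[of "order G" p] pos p(1) by (metis not_prime_unit neq0_conv)
    then obtain H where H: "subgroup H G" "card H = p ^ multiplicity p (order G)"
      using sylow_thm[OF p(1) is_group _ finite_carrier] by blast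
    have "multiplicity p (order G) \<noteq> 0" using p pos by (simp add: prime_multiplicity_gt_zero_iff)
    then have "card H \<noteq> 1" using H(2) prime_gt_1_nat[OF p(1)] by (simp add: power_eq_1_iff)
    then have "H \<noteq> {\<one>}" by auto
    then obtain x where x: "x \<in> H" "x \<noteq> \<one>" using subgroup.one_closed[OF H(1)] by blast
    have xc: "x \<in> carrier G" using subgroup.subset[OF H(1)] x by blast
    have "2 dvd ord x" using ord_dvd_of_cyc[OF xc, of z] assms x xc z by (simp add: dominating_def)
    moreover have "ord x dvd card H" using order_subgroup_pow[OF H(1) x(1)] pow_eq_id xc by blast
    ultimately have "2 dvd p ^ multiplicity p (order G)" using H(2) dvd_trans by metis
    then have "2 dvd p" using prime_dvd_power two_is_prime_nat by blast
    then show "p = 2" using p(1) primes_dvd_imp_eq two_is_prime_nat by metis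
  qed
  obtain m where m: "order G = 2 ^ multiplicity 2 (order G) * m" "odd m"
    using multiplicity_decompose'[of "order G" 2] pos by auto
  have "m = 1"
  proof (rule ccontr)
    assume "m \<noteq> 1"
    then obtain p where p: "prime p" "p dvd m" using prime_factor_nat by blast
    then have "p dvd order G" using m(1) by (metis dvd_mult)
    then show False using two p m(2) by blast
  qed
  then show ?thesis using m(1) that by simp
qed

text \<open>
  \<open>H\<close> acts on its right cosets with orbits of 2-power size. The number of cosets is even and \<open>H\<close>
  itself is a fixed point, so there is a second one.
\<close>
lemma normalizer_grows:
  assumes ord: "order G = 2 ^ N" and H: "subgroup H G" and ne: "H \<noteq> carrier G"
  obtains g where "g \<in> carrier G" "g \<notin> H" "\<And>h. h \<in> H \<Longrightarrow> g \<otimes> h \<otimes> inv g \<in> H"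
proof -
  let ?E = "rcosets H"
  let ?K = "G\<lparr>carrier := H\<rparr>"
  \<comment> \<open>The inverse turns right multiplication into a left action. The function is
    restricted to the cosets because \<open>Bij\<close> consists of extensional functions.\<close>
  let ?\<phi> = "\<lambda>h. \<lambda>R\<in>?E. R #> inv h"
  have Hc: "H \<subseteq> carrier G" using subgroup.subset[OF H] .
  interpret K: group ?K using H subgroup_imp_group by blast
  have E: "R #> x \<in> ?E" if "R \<in> ?E" "x \<in> carrier G" for R x
    using that Hc by (auto simp: RCOSETS_def coset_mult_assoc)
  have EC: "R \<subseteq> carrier G" if "R \<in> ?E" for R
    using that rcosets_subset_PowG[OF H] by auto
  have canc: "(R #> inv h) #> h = R" "(R #> h) #> inv h = R" if "R \<in> ?E" "h \<in> carrier G" for R h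
    using that EC[OF that(1)] by (simp_all add: coset_mult_assoc)
  have bij: "?\<phi> h \<in> Bij ?E" if "h \<in> H" for h
  proof -
    have hc: "h \<in> carrier G" using that Hc by blast
    have "bij_betw (\<lambda>R. R #> inv h) ?E ?E"
      by (rule bij_betw_byWitness[where f' = "\<lambda>R. R #> h"]) (use hc canc E in auto)
    then have "bij_betw (?\<phi> h) ?E ?E" by (simp cong: bij_betw_cong)
    then show ?thesis by (simp add: Bij_def)
  qed
  have act: "group_action ?K ?E ?\<phi>"
    unfolding group_action_def group_hom_def group_hom_axioms_def
  proof (intro conjI K.is_group group_BijGroup homI)
    fix x assume "x \<in> carrier ?K"
    then show "?\<phi> x \<in> carrier (BijGroup ?E)" using bij by (simp add: BijGroup_def)
  next
    fix x y assume "x \<in> carrier ?K" "y \<in> carrier ?K"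
    then have xy: "x \<in> H" "y \<in> H" "x \<in> carrier G" "y \<in> carrier G" using Hc by auto
    have "?\<phi> (x \<otimes> y) = compose ?E (?\<phi> x) (?\<phi> y)"
      using xy E EC by (auto simp: compose_def fun_eq_iff coset_mult_assoc inv_mult_group)
    then show "?\<phi> (x \<otimes>\<^bsub>?K\<^esub> y) = ?\<phi> x \<otimes>\<^bsub>BijGroup ?E\<^esub> ?\<phi> y"
      using bij xy by (simp add: BijGroup_def)
  qed
  interpret A: group_action ?K ?E ?\<phi> by (rule act)
  have lag: "card ?E * card H = 2 ^ N" using lagrange[OF H] ord by simp
  then have "card H dvd 2 ^ N" by (metis dvd_triv_right)
  then obtain j where j: "card H = 2 ^ j" using divides_primepow_nat[OF two_is_prime_nat] by blast
  have finH: "finite H" using Hc finite_carrier finite_subset by blast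
  have orb: "card (orbit ?K ?\<phi> R) = 1 \<or> even (card (orbit ?K ?\<phi> R))" if "R \<in> ?E" for R
  proof -
    have "order ?K = 2 ^ j" using j by (simp add: order_def)
    then have "card (orbit ?K ?\<phi> R) dvd 2 ^ j"
      using A.orbit_stabilizer_theorem[OF that] by (metis dvd_triv_left)
    then obtain i where "card (orbit ?K ?\<phi> R) = 2 ^ i"
      using divides_primepow_nat[OF two_is_prime_nat] by blast
    then show ?thesis by (cases i) auto
  qed
  \<comment> \<open>An infinite set of cosets would have \<open>card\<close> 0, making the product
    in \<open>lag\<close> zero.\<close>
  have finE: "finite ?E" using lag by (metis card.infinite mult_0 power_not_zero zero_neq_numeral)
  have HE: "H \<in> ?E" using subgroup.subgroup_in_rcosets[OF H is_group] .
  have orbH: "orbit ?K ?\<phi> H = {H}"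
  proof -
    have "H #> inv h = H" if "h \<in> H" for h
      using coset_join2[OF _ H] that Hc subgroup.m_inv_closed[OF H that] by blast
    then show ?thesis using HE subgroup.one_closed[OF H] unfolding orbit_def by auto
  qed
  have evenE: "even (card ?E)"
  proof -
    have "card ?E \<noteq> 1"
    proof
      assume "card ?E = 1"
      then have "card H = card (carrier G)" using lag ord by (simp add: order_def)
      then show False using ne card_subset_eq[OF finite_carrier Hc] by blast
    qed
    moreover have "card ?E dvd 2 ^ N" using lag by (metis dvd_triv_left)
    then obtain i where "card ?E = 2 ^ i" using divides_primepow_nat[OF two_is_prime_nat] by blast
    ultimately show ?thesis by (cases i) auto
  qed
  \<comment> \<open>If \<open>{H}\<close> were the only orbit of size 1, all others would be even
    and the number of cosets would be odd.\<close>
  have "\<exists>R\<in>?E. R \<noteq> H \<and> card (orbit ?K ?\<phi> R) = 1"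
  proof (rule ccontr)
    assume none: "\<not> ?thesis"
    let ?O = "orbits ?K ?E ?\<phi>"
    have finO: "finite ?O" unfolding orbits_def using finE by simp
    have H_O: "{H} \<in> ?O" unfolding orbits_def using HE orbH by auto
    have "even (card B)" if B: "B \<in> ?O - {{H}}" for B
    proof -
      from B obtain R where R: "R \<in> ?E" "B = orbit ?K ?\<phi> R" "B \<noteq> {H}" unfolding orbits_def by blast
      then have "R \<noteq> H" using orbH by auto
      then show ?thesis using none orb R by blast
    qed
    then have "even (\<Sum>B\<in>?O - {{H}}. card B)" by (intro dvd_sum) auto
    moreover have "card ?E = (\<Sum>B\<in>?O. card B)"
      using A.disjoint_sum[OF finE, of "\<lambda>_. 1::nat"] by simp
    then have "card ?E = 1 + (\<Sum>B\<in>?O - {{H}}. card B)"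
      using sum.remove[OF finO H_O, of card] by simp
    ultimately show False using evenE by simp
  qed
  then obtain R where R: "R \<in> ?E" "R \<noteq> H" "card (orbit ?K ?\<phi> R) = 1" by blast
  then obtain g where g: "g \<in> carrier G" "R = H #> g" by (auto simp: RCOSETS_def)
  have orbR: "orbit ?K ?\<phi> R = {R}"
    using R(3) A.orbit_refl[OF R(1)] card_1_singletonE by (metis singletonD)
  have "g \<notin> H" using coset_join2[OF g(1) H] R(2) g(2) by blast
  moreover have "g \<otimes> h \<otimes> inv g \<in> H" if "h \<in> H" for h
  proof -
    have h: "h \<in> carrier G" "inv h \<in> H" using that Hc subgroup.m_inv_closed[OF H] by auto
    \<comment> \<open>Acting by \<open>inv h\<close> is right multiplication by \<open>h\<close>.
      That it fixes the coset of \<open>g\<close> says that \<open>g\<close> conjugates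
      \<open>h\<close> into \<open>H\<close>.\<close>
    have "?\<phi> (inv h) R \<in> orbit ?K ?\<phi> R" using h(2) unfolding orbit_def by force
    then have "R #> h = R" using orbR R(1) h by simp
    then have "H #> (g \<otimes> h) = H #> g" using g h Hc by (simp add: coset_mult_assoc)
    then have "g \<otimes> h \<in> H #> g" using rcos_self[OF _ H, of "g \<otimes> h"] g h by auto
    then obtain k where "k \<in> H" "g \<otimes> h = k \<otimes> g" by (auto simp: r_coset_def)
    then have "g \<otimes> h \<otimes> inv g = k" using g h Hc by (metis inv_solve_right m_closed subsetD)
    then show ?thesis using \<open>k \<in> H\<close> by simp
  qed
  ultimately show ?thesis using that g(1) by blast
qed

end

section \<open>Conjugation and inversion of a cyclic subgroup\<close>

context group begin

text \<open>Conjugation is taken on the right, matching the relation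
  \<open>y\<^sup>-\<^sup>1xy = x\<^sup>-\<^sup>1\<close> of the presentation.\<close>

definition conj_by :: "'a \<Rightarrow> 'a \<Rightarrow> 'a" where "conj_by g x = inv g \<otimes> x \<otimes> g"

lemma conj_by_closed [simp]: "g \<in> carrier G \<Longrightarrow> x \<in> carrier G \<Longrightarrow> conj_by g x \<in> carrier G"
  by (simp add: conj_by_def)

lemma group_hom_conj_by: "g \<in> carrier G \<Longrightarrow> group_hom G G (conj_by g)"
proof (unfold_locales, rule homI)
  fix x y assume "g \<in> carrier G" "x \<in> carrier G" "y \<in> carrier G"
  moreover from this have "g \<otimes> (inv g \<otimes> (y \<otimes> g)) = y \<otimes> g"
    by (simp add: m_assoc[symmetric])
  ultimately show "conj_by g (x \<otimes> y) = conj_by g x \<otimes> conj_by g y"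
    by (simp add: conj_by_def m_assoc)
qed simp

lemma conj_by_int_pow: "g \<in> carrier G \<Longrightarrow> x \<in> carrier G \<Longrightarrow> conj_by g (x [^] (k::int)) = conj_by g x [^] k"
  by (rule group_hom.hom_int_pow[OF group_hom_conj_by])

lemma conj_by_mult_left:
  assumes "g \<in> carrier G" "h \<in> carrier G" "x \<in> carrier G"
  shows "conj_by (g \<otimes> h) x = conj_by h (conj_by g x)"
  using assms by (simp add: conj_by_def inv_mult_group m_assoc)

lemma conj_by_swap: "g \<in> carrier G \<Longrightarrow> x \<in> carrier G \<Longrightarrow> x \<otimes> g = g \<otimes> conj_by g x"
  unfolding conj_by_def by (metis inv_closed l_one m_assoc m_closed r_inv)

lemma conj_by_eq_one_iff: "g \<in> carrier G \<Longrightarrow> x \<in> carrier G \<Longrightarrow> conj_by g x = \<one> \<longleftrightarrow> x = \<one>"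
proof -
  assume gx: "g \<in> carrier G" "x \<in> carrier G"
  then have "x = \<one>" if "conj_by g x = \<one>"
    using conj_by_swap[OF gx] right_cancel[of g x \<one>] that by simp
  with gx show ?thesis by (auto simp: conj_by_def)
qed

lemma ord_conj_by:
  assumes "g \<in> carrier G" "x \<in> carrier G" shows "ord (conj_by g x) = ord x"
proof -
  have "conj_by g x [^] n = \<one> \<longleftrightarrow> ord x dvd n" for n :: nat
    using group_hom.hom_nat_pow[OF group_hom_conj_by[OF assms(1)] assms(2)] assms
    by (metis conj_by_eq_one_iff nat_pow_closed pow_eq_id)
  then show ?thesis using ord_unique assms by simp
qed

text \<open>The presentation of \<open>Q\<^sub>4\<^sub>n\<close>, together with faithfulness of the normal form \<open>a\<^sup>i\<close>, \<open>a\<^sup>ib\<close>.\<close>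
definition quaternion_gens :: "'a \<Rightarrow> 'a \<Rightarrow> nat \<Rightarrow> bool" where
  "quaternion_gens a b n \<longleftrightarrow>
     a \<in> carrier G \<and> b \<in> carrier G \<and> ord a = 2 * n \<and> b \<notin> generate G {a} \<and>
     b \<otimes> b = a [^] n \<and> conj_by b a = inv a \<and>
     carrier G = generate G {a} \<union> (\<lambda>x. x \<otimes> b) ` generate G {a}"

end

context finite_group begin

lemma cyc_int: "x \<in> carrier G \<Longrightarrow> y \<in> cyc x \<longleftrightarrow> (\<exists>k::int. y = x [^] k)"
  by (auto simp: generate_pow)

lemma cyc_subgroup: "x \<in> carrier G \<Longrightarrow> subgroup (cyc x) G"
  by (rule generate_is_subgroup) simp

lemma int_pow_eq_one: "x \<in> carrier G \<Longrightarrow> ord x = 2 ^ m \<Longrightarrow> x [^] (k::int) = \<one> \<longleftrightarrow> 2 ^ m dvd k"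
  using int_pow_eq_id by simp

text \<open>The cyclic subgroup of an involution \<open>x\<close> is \<open>{\<one>, x}\<close>, and
  it contains \<open>z\<close>.\<close>

lemma dominating_involution:
  assumes "dominating z" "x \<in> carrier G" "x \<otimes> x = \<one>" "x \<noteq> \<one>" shows "x = z"
proof -
  have z: "z \<in> carrier G" "ord z = 2" "z \<in> cyc x" using assms by (auto simp: dominating_def)
  have "x [^] (2::nat) = \<one>" using assms by (simp add: numeral_2_eq_2)
  then have "ord x dvd 2" using pow_eq_id assms by blast
  moreover have "ord x \<noteq> 1" using ord_eq_1 assms by blast
  ultimately have "ord x = 2" using prime_nat_iff two_is_prime_nat by blast
  have "card (cyc x) = 2" using generate_pow_card[OF assms(2)] \<open>ord x = 2\<close> by simp
  have "{\<one>, x} = cyc x"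
  proof (rule card_subset_eq)
    show "finite (cyc x)" using cyc_carrier assms(2) finite_carrier finite_subset by blast
    show "card {\<one>, x} = card (cyc x)" using \<open>card (cyc x) = 2\<close> assms(4) by simp
  qed (use one_in_cyc cyc_self in auto)
  then have "z \<in> {\<one>, x}" using z by simp
  moreover have "z \<noteq> \<one>" using z by auto
  ultimately show ?thesis by simp
qed

text \<open>Writing the conjugate of \<open>a\<close> and the square of \<open>b\<close> as powers
  of \<open>a\<close> reduces the claim to the congruences of
  \<open>two_adic_inverting\<close>.\<close>

lemma dominating_inverting:
  assumes dom: "dominating z"
    and a: "a \<in> carrier G" "ord a = 2 ^ m" and max: "\<And>x. x \<in> carrier G \<Longrightarrow> ord x dvd 2 ^ m"
    and b: "b \<in> carrier G" "b \<notin> cyc a" "conj_by b a \<in> cyc a" "b \<otimes> b \<in> cyc a"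
  shows "conj_by b a = inv a" "b \<otimes> b = a [^] ((2::nat) ^ (m - 1))"
proof -
  obtain r :: int where r: "conj_by b a = a [^] r" using cyc_int a b(3) by blast
  obtain s :: int where s: "b \<otimes> b = a [^] s" using cyc_int a b(4) by blast
  note one = int_pow_eq_one[OF a]
  have m0: "m \<noteq> 0"
  proof
    assume "m = 0"
    then have "ord b = 1" using max[OF b(1)] by simp
    then show False using ord_eq_1 b one_in_cyc by blast
  qed
  have z: "z \<in> cyc a"
    using dom a m0 ord_eq_1[of a] by (auto simp: dominating_def)
  have conj: "conj_by b (a [^] (i::int)) = a [^] (r * i)" for i
    using conj_by_int_pow a b r by (simp add: int_pow_pow)
  \<comment> \<open>For odd \<open>s\<close> the square of \<open>b\<close> would generate
    \<open>cyc a\<close>, so the order of \<open>b\<close> would exceed the maximum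
    \<open>2 ^ m\<close>.\<close>
  have "even s"
  proof (rule ccontr)
    assume "odd s"
    have "b [^] (2::nat) = a [^] s" using s b by (simp add: numeral_2_eq_2)
    then have "b [^] (2 * 2 ^ (m - 1) :: nat) = a [^] (s * 2 ^ (m - 1))"
      using a b by (metis int_pow_int int_pow_pow nat_pow_pow of_nat_numeral of_nat_power)
    moreover have "2 * 2 ^ (m - 1) = (2::nat) ^ m" using m0 by (cases m) auto
    moreover have "b [^] ((2::nat) ^ m) = \<one>" using max[OF b(1)] pow_eq_id b by blast
    ultimately have "2 ^ m dvd s * 2 ^ (m - 1)" using one by metis
    then have "2 ^ m dvd (2::int) ^ (m - 1)"
      using two_power_coprime_odd[OF \<open>odd s\<close>] coprime_dvd_mult_right_iff by blast
    then have "(2::int) ^ m \<le> 2 ^ (m - 1)" by (rule zdvd_imp_le) simp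
    then show False using m0 by simp
  qed
  \<comment> \<open>The element \<open>a\<^sup>ib\<close> squares to \<open>a\<close> to the power
    \<open>s + i * (r + 1)\<close>. If this were trivial, \<open>a\<^sup>ib\<close> would be an
    involution outside \<open>cyc a\<close>, whereas \<open>z\<close> lies inside.\<close>
  moreover have "\<not> 2 ^ m dvd s + i * (r + 1)" for i
  proof
    assume "2 ^ m dvd s + i * (r + 1)"
    let ?x = "a [^] i \<otimes> b"
    have x: "?x \<in> carrier G" using a b by simp
    have "b \<otimes> (a [^] i \<otimes> b) = (b \<otimes> b) \<otimes> conj_by b (a [^] i)"
      using conj_by_swap[of b "a [^] i"] a b by (simp add: m_assoc)
    then have "?x \<otimes> ?x = a [^] i \<otimes> (a [^] s \<otimes> a [^] (r * i))"
      using a b s conj by (simp add: m_assoc)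
    also have "\<dots> = a [^] (s + i * (r + 1))" using a by (simp add: int_pow_mult algebra_simps)
    also have "\<dots> = \<one>" using one \<open>2 ^ m dvd s + i * (r + 1)\<close> by blast
    finally have "?x \<otimes> ?x = \<one>" .
    moreover have nx: "?x \<notin> cyc a"
    proof
      assume "?x \<in> cyc a"
      then obtain k :: int where "a [^] i \<otimes> b = a [^] k" using cyc_int a by blast
      then have "b = a [^] (- i) \<otimes> a [^] k"
        using a b by (metis inv_solve_left int_pow_closed int_pow_neg)
      then have "b = a [^] (k - i)" using a by (simp flip: int_pow_mult)
      then show False using b cyc_int a by blast
    qed
    moreover have "?x \<noteq> \<one>" using nx one_in_cyc by metis
    ultimately show False using dominating_involution[OF dom x] z by metis
  qed
  \<comment> \<open>This expresses that \<open>b\<close> commutes with its own square.\<close>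
  moreover have "2 ^ m dvd s * (r - 1)"
  proof -
    have "conj_by b (b \<otimes> b) = b \<otimes> b" using b by (simp add: conj_by_def m_assoc[symmetric])
    then have "a [^] (r * s) = a [^] s" using conj s by simp
    then have "2 ^ m dvd r * s - s" using int_pow_eq[OF a(1)] a(2) by (metis dvd_minus_iff minus_diff_eq of_nat_numeral of_nat_power)
    then show ?thesis by (simp add: algebra_simps)
  qed
  ultimately have ar: "2 ^ m dvd r + 1" "2 ^ (m - 1) dvd s" "\<not> 2 ^ m dvd s"
    using two_adic_inverting by blast+
  have "a [^] r \<otimes> a = \<one>" using one[of "r + 1"] ar(1) a by (simp add: int_pow_mult)
  then show "conj_by b a = inv a" using r a by (metis inv_equality int_pow_closed)
  \<comment> \<open>The exponent \<open>s\<close> is an odd multiple of \<open>2 ^ (m - 1)\<close>,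
    and all of these agree modulo \<open>2 ^ m\<close>.\<close>
  obtain q where q: "s = 2 ^ (m - 1) * q" using ar(2) by blast
  have "(2::int) ^ m = 2 ^ (m - 1) * 2" using m0 by (cases m) auto
  then have "odd q" using ar(3) q by auto
  then obtain q' where "q = 2 * q' + 1" by (elim oddE)
  then have "s - 2 ^ (m - 1) = 2 ^ m * q'"
    using q \<open>(2::int) ^ m = 2 ^ (m - 1) * 2\<close> by (simp add: algebra_simps)
  then have "a [^] ((2::int) ^ (m - 1)) = a [^] s" using int_pow_eq[OF a(1)] a(2) by simp
  then show "b \<otimes> b = a [^] ((2::nat) ^ (m - 1))" using s by (metis int_pow_int of_nat_numeral of_nat_power)
qed

end

section \<open>Two-groups with a unique involution\<close>

text \<open>Squares are 0 or 1 modulo 4. Hence inversion on a cyclic group of order divisible by 4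
  is not the square of an automorphism.\<close>

lemma not_four_dvd_square_plus_one: "\<not> 4 dvd q * q + (1::int)"
proof (cases "even q")
  case True
  then obtain k where "q = 2 * k" by blast
  then have "q * q + 1 = 4 * (k * k) + 1" by simp
  moreover have "\<not> 4 dvd 4 * (k * k) + 1" by presburger
  ultimately show ?thesis by simp
next
  case False
  then obtain k where "q = 2 * k + 1" by (elim oddE)
  then have "q * q + 1 = 4 * (k * k + k) + 2" by (simp add: algebra_simps)
  moreover have "\<not> 4 dvd 4 * (k * k + k) + 2" by presburger
  ultimately show ?thesis by metis
qed

context finite_group begin

lemma conj_by_cyc:
  assumes "g \<in> carrier G" "a \<in> carrier G" "conj_by g a \<in> cyc a" "x \<in> cyc a"
  shows "conj_by g x \<in> cyc a"
proof -
  obtain k :: int where "x = a [^] k" using cyc_int assms by blast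
  then have "conj_by g x = conj_by g a [^] k" using conj_by_int_pow assms by simp
  then show ?thesis using subgroup_int_pow_closed[OF cyc_subgroup] assms by simp
qed

lemma conj_by_nat_pow_cyc:
  assumes "g \<in> carrier G" "a \<in> carrier G" "conj_by g a \<in> cyc a"
  shows "conj_by (g [^] (k::nat)) a \<in> cyc a"
proof (induction k)
  case 0
  then show ?case using assms cyc_self by (simp add: conj_by_def)
next
  case (Suc k)
  then show ?case using assms conj_by_cyc by (simp add: conj_by_mult_left)
qed

text \<open>Conjugating \<open>a\<close> into \<open>cyc a\<close> is inherited by products, and by
  inverses because in a finite group an inverse is a natural power.\<close>

lemma subgroup_normalizer_cyc:
  assumes a: "a \<in> carrier G"
  shows "subgroup {g \<in> carrier G. conj_by g a \<in> cyc a} G"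
proof (rule subgroupI)
  have "conj_by \<one> a = a" using a by (simp add: conj_by_def)
  then show "{g \<in> carrier G. conj_by g a \<in> cyc a} \<noteq> {}" using cyc_self[of a] by auto
next
  fix g assume g: "g \<in> {g \<in> carrier G. conj_by g a \<in> cyc a}"
  have "g [^] (ord g - 1) \<otimes> g = g [^] ord g"
    using g ord_pos[of g] by (metis (no_types, lifting) Suc_diff_1 mem_Collect_eq nat_pow_Suc)
  then have "inv g = g [^] (ord g - 1)" using g by (intro inv_equality) auto
  then show "inv g \<in> {g \<in> carrier G. conj_by g a \<in> cyc a}"
    using g conj_by_nat_pow_cyc a by simp
next
  fix g h assume "g \<in> {g \<in> carrier G. conj_by g a \<in> cyc a}" "h \<in> {g \<in> carrier G. conj_by g a \<in> cyc a}"
  then show "g \<otimes> h \<in> {g \<in> carrier G. conj_by g a \<in> cyc a}"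
    using a conj_by_cyc by (simp add: conj_by_mult_left)
qed auto

text \<open>Repeated squaring of \<open>g\<close> reaches an element \<open>b\<close> outside
  \<open>cyc a\<close> whose square lies inside, so \<open>dominating_inverting\<close> applies to
  \<open>b\<close>. If \<open>b\<close> were a proper power of \<open>g\<close>, it would be the
  square of some \<open>c\<close> acting as \<open>a \<mapsto> a\<^sup>q\<close> with
  \<open>q * q\<close> congruent to -1 modulo 4.\<close>

lemma normalizer_inverting:
  assumes dom: "dominating z" and m: "m \<ge> 2"
    and a: "a \<in> carrier G" "ord a = 2 ^ m" and max: "\<And>x. x \<in> carrier G \<Longrightarrow> ord x dvd 2 ^ m"
    and g: "g \<in> carrier G" "g \<notin> cyc a" "conj_by g a \<in> cyc a"
  shows "conj_by g a = inv a" "g \<otimes> g = a [^] ((2::nat) ^ (m - 1))"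
proof -
  let ?P = "\<lambda>j::nat. g [^] ((2::nat) ^ j) \<in> cyc a"
  have "g [^] ((2::nat) ^ m) = \<one>" using max[OF g(1)] pow_eq_id[OF g(1)] by blast
  then have "?P m" using one_in_cyc by simp
  then have PL: "?P (LEAST j. ?P j)" by (rule LeastI)
  have "\<not> ?P 0" using g by simp
  \<comment> \<open>The least exponent is positive because \<open>g\<close> itself is outside
    \<open>cyc a\<close>; one step earlier the power is still outside.\<close>
  then obtain i where i: "(LEAST j. ?P j) = Suc i" using PL by (metis not0_implies_Suc)
  have ni: "\<not> ?P i" using not_less_Least[of i ?P] i by simp
  have si: "?P (Suc i)" using PL i by simp
  define b where "b = g [^] ((2::nat) ^ i)"
  have bb: "b \<otimes> b = g [^] ((2::nat) ^ Suc i)"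
    using g by (simp add: b_def nat_pow_mult mult_2)
  have b: "b \<in> carrier G" "b \<notin> cyc a" "conj_by b a \<in> cyc a" "b \<otimes> b \<in> cyc a"
    using g ni si bb conj_by_nat_pow_cyc a by (auto simp: b_def)
  note inv_b = dominating_inverting[OF dom a max b]
  have "i = 0"
  proof (rule ccontr)
    assume "i \<noteq> 0"
    then obtain l where l: "i = Suc l" by (metis not0_implies_Suc)
    define c where "c = g [^] ((2::nat) ^ l)"
    have c: "c \<in> carrier G" "b = c \<otimes> c" "conj_by c a \<in> cyc a"
      using g l conj_by_nat_pow_cyc a by (auto simp: b_def c_def nat_pow_mult mult_2)
    then obtain q :: int where q: "conj_by c a = a [^] q" using cyc_int a by blast
    have "conj_by b a = a [^] (q * q)"
      using c a q by (simp add: conj_by_mult_left conj_by_int_pow int_pow_pow)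
    then have "a [^] (q * q) \<otimes> a = \<one>" using inv_b(1) a l_inv by metis
    then have "a [^] (q * q + 1) = \<one>" using a by (simp add: int_pow_mult)
    then have "2 ^ m dvd q * q + 1" using int_pow_eq_one[OF a] by blast
    moreover have "(4::int) dvd 2 ^ m" using le_imp_power_dvd[OF m, of "2::int"] by simp
    ultimately show False using not_four_dvd_square_plus_one dvd_trans by blast
  qed
  then have "b = g" using g by (simp add: b_def)
  then show "conj_by g a = inv a" "g \<otimes> g = a [^] ((2::nat) ^ (m - 1))" using inv_b by auto
qed

text \<open>If \<open>g \<otimes> inv h\<close> were outside \<open>cyc a\<close>, it would invert
  \<open>a\<close>, as \<open>g\<close> and \<open>h\<close> do. Then \<open>g\<close> would act as
  a composition of two inversions, that is trivially, forcing \<open>inv a = a\<close> although 4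
  divides the order of \<open>a\<close>.\<close>

lemma normalizer_cosets:
  assumes dom: "dominating z" and m: "m \<ge> 2"
    and a: "a \<in> carrier G" "ord a = 2 ^ m" and max: "\<And>x. x \<in> carrier G \<Longrightarrow> ord x dvd 2 ^ m"
    and g: "g \<in> carrier G" "g \<notin> cyc a" "conj_by g a \<in> cyc a"
    and h: "h \<in> carrier G" "h \<notin> cyc a" "conj_by h a \<in> cyc a"
  shows "g \<in> (\<lambda>x. x \<otimes> h) ` cyc a"
proof -
  note N = subgroup_normalizer_cyc[OF a(1)]
  let ?k = "g \<otimes> inv h"
  have k: "?k \<in> carrier G" "conj_by ?k a \<in> cyc a"
    using subgroup.m_closed[OF N, of g "inv h"] subgroup.m_inv_closed[OF N, of h] g h by auto
  have "?k \<in> cyc a"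
  proof (rule ccontr)
    assume nk: "?k \<notin> cyc a"
    have "conj_by g a = inv a" "conj_by h a = inv a" "conj_by ?k a = inv a"
      using normalizer_inverting[OF dom m a max] g h k nk by blast+
    moreover have "conj_by g a = conj_by h (conj_by ?k a)"
      using conj_by_mult_left[of ?k h a] g h a by (simp add: m_assoc)
    moreover have "conj_by h (inv a) = inv (conj_by h a)"
      using conj_by_int_pow[OF h(1) a(1), of "-1"] a h by (simp add: int_pow_neg)
    ultimately have "inv a = a" using a by simp
    then have "a [^] (2::nat) = \<one>" using a by (metis l_one nat_pow_0 nat_pow_Suc numeral_2_eq_2 r_inv)
    then have "(2::nat) ^ m dvd 2" using pow_eq_id a by metis
    moreover have "(4::nat) dvd 2 ^ m" using le_imp_power_dvd[OF m, of "2::nat"] by simp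
    ultimately show False using dvd_trans[of 4 "2 ^ m" "2::nat"] by simp
  qed
  moreover have "g = ?k \<otimes> h" using g h by (simp add: m_assoc)
  ultimately show ?thesis by blast
qed

lemma maximal_cyclic_normal:
  assumes dom: "dominating z" and m: "m \<ge> 2"
    and a: "a \<in> carrier G" "ord a = 2 ^ m" and max: "\<And>x. x \<in> carrier G \<Longrightarrow> ord x dvd 2 ^ m"
    and g: "g \<in> carrier G"
  shows "conj_by g a \<in> cyc a"
proof (cases "m = 2")
  case True
  have z: "z \<in> cyc a"
    using dom a m ord_eq_1[of a] by (auto simp: dominating_def)
  \<comment> \<open>Every fourth power is trivial, so every square is the identity or the unique
    involution.\<close>
  have sq: "x \<otimes> x \<in> cyc a" if x: "x \<in> carrier G" for x
  proof -
    have "x [^] (4::nat) = \<one>" using max[OF x] pow_eq_id[OF x] True by simp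
    moreover have "x [^] (4::nat) = (x \<otimes> x) \<otimes> (x \<otimes> x)"
      using x by (simp add: numeral_eq_Suc m_assoc)
    ultimately have "x \<otimes> x = \<one> \<or> x \<otimes> x = z"
      using dominating_involution[OF dom, of "x \<otimes> x"] x by auto
    then show ?thesis using z one_in_cyc by metis
  qed
  note S = cyc_subgroup[OF a(1)]
  \<comment> \<open>The conjugate is written with the squares of \<open>g\<close> and
    \<open>a \<otimes> g\<close> and the inverse of \<open>a\<close>, all of which lie in
    \<open>cyc a\<close>.\<close>
  have "conj_by g a = inv (g \<otimes> g) \<otimes> inv a \<otimes> ((a \<otimes> g) \<otimes> (a \<otimes> g))"
  proof -
    have "inv (g \<otimes> g) \<otimes> inv a \<otimes> ((a \<otimes> g) \<otimes> (a \<otimes> g)) =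
      inv g \<otimes> (inv g \<otimes> ((inv a \<otimes> a) \<otimes> (g \<otimes> (a \<otimes> g))))"
      using g a by (simp only: inv_mult_group m_assoc inv_closed m_closed)
    also have "\<dots> = inv g \<otimes> ((inv g \<otimes> g) \<otimes> (a \<otimes> g))"
      using g a by (simp flip: m_assoc)
    finally show ?thesis using g a by (simp add: conj_by_def m_assoc)
  qed
  then show ?thesis
    using sq[OF g] sq[of "a \<otimes> g"] g a cyc_self[of a]
    by (simp add: subgroup.m_closed[OF S] subgroup.m_inv_closed[OF S])
next
  case False
  then have m3: "m \<ge> 3" using m by simp
  let ?N = "{g \<in> carrier G. conj_by g a \<in> cyc a}"
  note N = subgroup_normalizer_cyc[OF a(1)]
  have "?N = carrier G"
  proof (rule ccontr)
    assume ne: "?N \<noteq> carrier G"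
    obtain M where "order G = 2 ^ M" using dominating_two_group[OF dom] .
    from normalizer_grows[OF this N ne] obtain h where
      h: "h \<in> carrier G" "h \<notin> ?N" "\<And>x. x \<in> ?N \<Longrightarrow> h \<otimes> x \<otimes> inv h \<in> ?N" by blast
    have "a \<in> ?N" using a cyc_self[of a] by (simp add: conj_by_def)
    define y where "y = conj_by (inv h) a"
    have "y = h \<otimes> a \<otimes> inv h" using h(1) by (simp add: y_def conj_by_def)
    then have y: "y \<in> carrier G" "conj_by y a \<in> cyc a" "ord y = 2 ^ m"
      using h(3)[OF \<open>a \<in> ?N\<close>] h(1) a ord_conj_by[of "inv h" a] by (simp_all add: y_def)
    \<comment> \<open>An element of \<open>?N\<close> outside \<open>cyc a\<close> has trivial
      fourth power, whereas the conjugate \<open>y\<close> of \<open>a\<close> has order at least 8.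
      So \<open>inv h\<close> conjugates \<open>a\<close> into \<open>cyc a\<close>, which puts
      \<open>h\<close> in \<open>?N\<close>.\<close>
    have "y \<in> cyc a"
    proof (rule ccontr)
      assume "y \<notin> cyc a"
      from normalizer_inverting(2)[OF dom m a max y(1) this y(2)]
      have yy: "y \<otimes> y = a [^] ((2::nat) ^ (m - 1))" .
      have "y [^] (4::nat) = (y \<otimes> y) \<otimes> (y \<otimes> y)"
        using y by (simp add: numeral_eq_Suc m_assoc)
      also have "\<dots> = a [^] ((2::nat) ^ (m - 1) + 2 ^ (m - 1))" using yy a by (simp add: nat_pow_mult)
      also have "(2::nat) ^ (m - 1) + 2 ^ (m - 1) = ord a" using a m by (cases m) auto
      finally have "y [^] (4::nat) = \<one>" using pow_ord_eq_1[OF a(1)] by (simp only:)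
      then have "(2::nat) ^ m dvd 4" using pow_eq_id y by metis
      moreover have "(8::nat) dvd 2 ^ m" using le_imp_power_dvd[OF m3, of "2::nat"] by simp
      ultimately show False using dvd_trans[of 8 "2 ^ m" "4::nat"] by simp
    qed
    then have "inv h \<in> ?N" using h(1) by (simp add: y_def)
    then have "inv (inv h) \<in> ?N" using subgroup.m_inv_closed[OF N] by blast
    then show False using h by simp
  qed
  then show ?thesis using g by blast
qed

theorem dominating_cyclic_or_quaternion:
  assumes dom: "dominating z"
  obtains a k where "k \<ge> 1" "a \<in> carrier G" "ord a = 2 ^ k" "carrier G = cyc a"
  | a b t where "t \<ge> 1" "quaternion_gens a b (2 ^ t)"
proof -
  obtain M where M: "order G = 2 ^ M" using dominating_two_group[OF dom] .
  have pw: "\<exists>i. ord x = 2 ^ i" if "x \<in> carrier G" for x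
    using ord_dvd_group_order[OF that] M divides_primepow_nat[OF two_is_prime_nat] by metis
  have z: "z \<in> carrier G" "ord z = 2" using dom by (auto simp: dominating_def)
  \<comment> \<open>All orders are powers of 2, so the largest one is a multiple of every
    other.\<close>
  have "Max (ord ` carrier G) \<in> ord ` carrier G" using finite_carrier z(1) by (intro Max_in) auto
  then obtain a where a: "a \<in> carrier G" "ord a = Max (ord ` carrier G)" by auto
  obtain m where m: "ord a = 2 ^ m" using pw a by blast
  have max: "ord x dvd 2 ^ m" if x: "x \<in> carrier G" for x
  proof -
    obtain i where i: "ord x = 2 ^ i" using pw x by blast
    have "ord x \<le> ord a" using a(2) x finite_carrier by simp
    then have "i \<le> m" using i m by simp
    then show ?thesis using i le_imp_power_dvd by simp
  qed
  have "m \<noteq> 0" using max[OF z(1)] z(2) by auto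
  consider "carrier G = cyc a" | "m = 1" | h where "m \<ge> 2" "h \<in> carrier G" "h \<notin> cyc a"
    using cyc_carrier[OF a(1)] \<open>m \<noteq> 0\<close> by fastforce
  then show ?thesis
  proof cases
    case 1
    then show ?thesis using that(1)[of m a] a m \<open>m \<noteq> 0\<close> by simp
  next
    case 2
    \<comment> \<open>All squares are trivial here, so the unique involution generates the
      group.\<close>
    have "x \<in> cyc z" if x: "x \<in> carrier G" for x
    proof -
      have "x [^] (2::nat) = \<one>" using max[OF x] pow_eq_id[OF x] 2 by simp
      then have "x \<otimes> x = \<one>" using x by (simp add: numeral_2_eq_2)
      then have "x = \<one> \<or> x = z" using dominating_involution[OF dom x] by blast
      then show ?thesis using one_in_cyc cyc_self by metis
    qed
    then have "carrier G = cyc z" using cyc_carrier z by blast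
    then show ?thesis using that(1)[of 1 z] z by simp
  next
    case (3 h)
    have normal: "conj_by g a \<in> cyc a" if "g \<in> carrier G" for g
      using maximal_cyclic_normal[OF dom 3(1) a(1) m _ that] max by blast
    have inverts: "conj_by h a = inv a" "h \<otimes> h = a [^] ((2::nat) ^ (m - 1))"
      using normalizer_inverting[OF dom 3(1) a(1) m _ 3(2,3) normal[OF 3(2)]] max by blast+
    \<comment> \<open>Since \<open>cyc a\<close> is normal, every element outside it falls under
      \<open>normalizer_cosets\<close> with the fixed representative \<open>h\<close>.\<close>
    have "x \<in> cyc a \<union> (\<lambda>x. x \<otimes> h) ` cyc a" if "x \<in> carrier G" for x
      using normalizer_cosets[OF dom 3(1) a(1) m _ that _ normal[OF that] 3(2,3) normal[OF 3(2)]]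
        max by blast
    then have "carrier G = cyc a \<union> (\<lambda>x. x \<otimes> h) ` cyc a"
      using cyc_carrier[OF a(1)] 3(2) by auto
    moreover have "ord a = 2 * 2 ^ (m - 1)" using m \<open>m \<noteq> 0\<close> by (cases m) auto
    ultimately have "quaternion_gens a h (2 ^ (m - 1))"
      using a(1) 3 inverts unfolding quaternion_gens_def by simp
    then show ?thesis using that(2)[of "m - 1" a h] 3(1) by simp
  qed
qed

end

section \<open>Cyclic and quaternion two-groups\<close>

context finite_group begin

lemma max_Omega_two_power:
  assumes "g \<in> carrier G" "ord g = 2 ^ k" "\<And>x. x \<in> carrier G \<Longrightarrow> ord x dvd 2 ^ k"
  shows "max_Omega = k"
proof (rule antisym)
  obtain h where h: "h \<in> carrier G" "num_prime_factors (ord h) = max_Omega" by (rule Omega_max)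
  then obtain i where "ord h = 2 ^ i" "i \<le> k"
    using assms(3) divides_primepow_nat[OF two_is_prime_nat] by metis
  then show "max_Omega \<le> k" using h(2) num_prime_factors_prime_power[OF two_is_prime_nat] by simp
  show "k \<le> max_Omega"
    using Omega_le[OF assms(1)] assms(2) num_prime_factors_prime_power[OF two_is_prime_nat] by simp
qed

text \<open>In a 2-group every element other than the identity has an involution among its
  powers.\<close>

lemma dominating_of_unique_involution:
  assumes ord: "order G = 2 ^ N" and z: "z \<in> carrier G" "ord z = 2"
    and unique: "\<And>x. x \<in> carrier G \<Longrightarrow> ord x = 2 \<Longrightarrow> x = z"
  shows "dominating z"
proof -
  have "z \<in> cyc x" if x: "x \<in> carrier G" "x \<noteq> \<one>" for x
  proof -
    obtain i where i: "ord x = 2 ^ i"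
      using ord_dvd_group_order[OF x(1)] ord divides_primepow_nat[OF two_is_prime_nat] by metis
    then have "i \<noteq> 0" using x ord_eq_1 by (metis power_0)
    then obtain l where l: "ord x = 2 ^ l * 2" using i by (cases i) auto
    have "ord (x [^] ((2::nat) ^ l)) = ord x div 2 ^ l"
      using ord_pow[OF x(1)] l by simp
    then have "x [^] ((2::nat) ^ l) = z" using unique x(1) l by simp
    then show ?thesis using cyc_pow[OF x(1)] by metis
  qed
  then show ?thesis using z by (simp add: dominating_def)
qed

text \<open>A power of \<open>a\<close> has order 2 only if its exponent is an odd multiple of
  \<open>2 ^ k\<close>, and such multiples agree modulo \<open>ord a\<close>.\<close>

lemma involution_in_cyc:
  assumes a: "a \<in> carrier G" "ord a = 2 ^ Suc k" and x: "x \<in> cyc a" "ord x = 2"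
  shows "x = a [^] ((2::nat) ^ k)"
proof -
  obtain i :: nat where i: "x = a [^] i" using x(1) cyc_eq[OF a(1)] by blast
  have xc: "x \<in> carrier G" using i a by simp
  have "x [^] (2::nat) = \<one>" using pow_ord_eq_1[OF xc] x(2) by simp
  then have "a [^] (i * 2) = \<one>" using i a by (simp add: nat_pow_pow)
  then have "2 ^ Suc k dvd i * 2" using pow_eq_id a by metis
  then have "2 ^ k dvd i" by simp
  then obtain j where j: "i = 2 ^ k * j" by blast
  have "odd j"
  proof
    assume "even j"
    then have "ord a dvd i" using j a(2) by auto
    then have "x = \<one>" using i a pow_eq_id by simp
    then show False using x(2) by simp
  qed
  then obtain l where "j = 2 * l + 1" by (elim oddE)
  then have "i = 2 ^ k + ord a * l" using j a(2) by (simp add: algebra_simps)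
  then have "x = a [^] ((2::nat) ^ k) \<otimes> (a [^] ord a) [^] l"
    using i a(1) by (simp only: nat_pow_mult nat_pow_pow nat_pow_closed)
  then show ?thesis using a(1) by simp
qed

lemma cyclic_two_group:
  assumes a: "a \<in> carrier G" "ord a = 2 ^ Suc k" and G: "carrier G = cyc a"
  shows "order G = 2 ^ Suc k" "dominating (a [^] ((2::nat) ^ k))" "max_Omega = Suc k"
proof -
  show o: "order G = 2 ^ Suc k" using generate_pow_card[OF a(1)] a(2) G by (simp add: order_def)
  have "ord (a [^] ((2::nat) ^ k)) = 2" using ord_pow[OF a(1), of "2 ^ k"] a(2) by simp
  then show "dominating (a [^] ((2::nat) ^ k))"
    using involution_in_cyc[OF a] G nat_pow_closed[OF a(1)]
    by (intro dominating_of_unique_involution[OF o]) blast+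
  show "max_Omega = Suc k"
    by (rule max_Omega_two_power[OF a]) (metis o ord_dvd_group_order)
qed

text \<open>Each \<open>x \<otimes> b\<close> with \<open>x\<close> in \<open>cyc a\<close> squares
  to \<open>b \<otimes> b\<close>, because moving \<open>b\<close> past \<open>x\<close> inverts
  \<open>x\<close>. So involutions occur only in \<open>cyc a\<close>, and elements outside it have
  trivial fourth power.\<close>

lemma quaternion_two_group:
  assumes q: "quaternion_gens a b (2 ^ t)" and t: "t \<ge> 1"
  shows "order G = 2 ^ (t + 2)" "dominating (a [^] ((2::nat) ^ t))" "max_Omega = t + 1"
proof -
  let ?z = "a [^] ((2::nat) ^ t)"
  have a: "a \<in> carrier G" "ord a = 2 ^ Suc t" and b: "b \<in> carrier G" "b \<notin> cyc a"
    and bb: "b \<otimes> b = ?z" and conj: "conj_by b a = inv a"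
    and G: "carrier G = cyc a \<union> (\<lambda>x. x \<otimes> b) ` cyc a"
    using q by (auto simp: quaternion_gens_def)
  have sub: "cyc a \<subseteq> carrier G" using cyc_carrier a by blast
  note S = cyc_subgroup[OF a(1)]
  have out: "x \<otimes> b \<notin> cyc a" if "x \<in> cyc a" for x
  proof
    assume "x \<otimes> b \<in> cyc a"
    then have "inv x \<otimes> (x \<otimes> b) \<in> cyc a"
      using that subgroup.m_closed[OF S] subgroup.m_inv_closed[OF S] by blast
    moreover have "inv x \<otimes> (x \<otimes> b) = b" using that sub b by (simp add: subset_iff flip: m_assoc)
    ultimately show False using b by simp
  qed
  have sq: "(x \<otimes> b) \<otimes> (x \<otimes> b) = ?z" if x: "x \<in> cyc a" for x
  proof -
    obtain k :: int where k: "x = a [^] k" using x cyc_int[OF a(1)] by blast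
    have "conj_by b x = a [^] (- k)"
      using conj_by_int_pow[OF b(1) a(1)] conj k a by (simp add: int_pow_inv int_pow_neg)
    then have "x \<otimes> b = b \<otimes> a [^] (- k)" using conj_by_swap[of b x] b k a by simp
    then have "b \<otimes> (x \<otimes> b) = ?z \<otimes> a [^] (- k)" using bb b a by (simp flip: m_assoc)
    moreover have "?z = a [^] int (2 ^ t)" by (simp only: int_pow_int)
    ultimately have "(x \<otimes> b) \<otimes> (x \<otimes> b) = a [^] k \<otimes> (a [^] int (2 ^ t) \<otimes> a [^] (- k))"
      using k a b by (simp add: m_assoc)
    also have "\<dots> = a [^] int (2 ^ t)" using a by (simp flip: int_pow_mult)
    finally show ?thesis by (simp only: int_pow_int)
  qed
  have oz: "ord ?z = 2" using ord_pow[OF a(1), of "2 ^ t"] a(2) by simp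
  have zc: "?z \<in> carrier G" using a by simp
  have fin: "finite (cyc a)" using sub finite_carrier finite_subset by blast
  have "inj_on (\<lambda>x. x \<otimes> b) (cyc a)" using sub b by (auto simp: inj_on_def subset_iff)
  then have "card ((\<lambda>x. x \<otimes> b) ` cyc a) = 2 ^ Suc t"
    using card_image generate_pow_card[OF a(1)] a(2) by metis
  moreover have "cyc a \<inter> (\<lambda>x. x \<otimes> b) ` cyc a = {}" using out by blast
  ultimately have "card (carrier G) = 2 ^ Suc t + 2 ^ Suc t"
    using G fin card_Un_disjoint generate_pow_card[OF a(1)] a(2) by (metis finite_imageI)
  then show o: "order G = 2 ^ (t + 2)" by (simp add: order_def)
  show "dominating ?z"
  proof (rule dominating_of_unique_involution[OF o zc oz])
    fix x assume x: "x \<in> carrier G" "ord x = 2"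
    then have "x [^] (2::nat) = \<one>" using pow_ord_eq_1 by metis
    then have "x \<otimes> x = \<one>" using x by (simp add: numeral_2_eq_2)
    moreover have "?z \<noteq> \<one>" using oz by auto
    ultimately have "x \<in> cyc a" using G x(1) sq by auto
    then show "x = ?z" using involution_in_cyc[OF a] x(2) by blast
  qed
  show "max_Omega = t + 1"
  proof (rule max_Omega_two_power[OF a(1)])
    show "ord a = 2 ^ (t + 1)" using a(2) by simp
    fix x assume x: "x \<in> carrier G"
    show "ord x dvd 2 ^ (t + 1)"
    proof (cases "x \<in> cyc a")
      case True
      then show ?thesis using ord_dvd_of_cyc[OF a(1)] a(2) by simp
    next
      case False
      then have xx: "x \<otimes> x = ?z" using x G sq by auto
      have "x [^] (4::nat) = (x \<otimes> x) \<otimes> (x \<otimes> x)" using x by (simp add: numeral_eq_Suc m_assoc)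
      also have "\<dots> = ?z [^] ord ?z" using xx oz zc by (simp add: numeral_2_eq_2)
      also have "\<dots> = \<one>" using zc by (rule pow_ord_eq_1)
      finally have "ord x dvd 4" using x pow_eq_id by simp
      \<comment> \<open>Here \<open>t \<ge> 1\<close> matters: it makes \<open>ord a\<close> a
        multiple of 4.\<close>
      moreover have "(4::nat) dvd 2 ^ (t + 1)" using le_imp_power_dvd[of 2 "t + 1" "2::nat"] t by simp
      ultimately show ?thesis by (rule dvd_trans)
    qed
  qed
qed

section \<open>Isomorphism with the integers modulo the order\<close>

lemma cyclic_iso_integer_mod_group:
  assumes a: "a \<in> carrier G" and G: "carrier G = cyc a"
  shows "G \<cong> integer_mod_group (ord a)"
proof -
  let ?n = "ord a"
  have n: "?n > 0" using ord_pos a .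
  let ?Z = "integer_mod_group ?n" and ?f = "\<lambda>i::int. a [^] i"
  have C: "carrier ?Z = {0..<int ?n}" using n by (simp add: carrier_integer_mod_group)
  have "?f \<in> iso ?Z G"
  proof (rule isoI)
    show "?f \<in> hom ?Z G"
    proof (rule homI)
      fix x y
      have "a [^] ((x + y) mod int ?n) = a [^] (x + y)"
        using int_pow_eq[OF a] by (simp add: minus_mod_eq_mult_div)
      then show "?f (x \<otimes>\<^bsub>?Z\<^esub> y) = ?f x \<otimes> ?f y" using a by (simp add: int_pow_mult)
    qed (simp add: a)
    show "bij_betw ?f (carrier ?Z) (carrier G)"
      unfolding bij_betw_def
    proof
      show "inj_on ?f (carrier ?Z)"
      proof (rule inj_onI)
        fix x y assume xy: "x \<in> carrier ?Z" "y \<in> carrier ?Z" "a [^] x = a [^] y"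
        then have "y mod int ?n = x mod int ?n" using int_pow_eq[OF a] by (simp add: mod_eq_dvd_iff)
        then show "x = y" using xy C by simp
      qed
      show "?f ` carrier ?Z = carrier G"
      proof (rule antisym; rule subsetI)
        fix x assume "x \<in> carrier G"
        then obtain k :: int where k: "x = a [^] k" using G cyc_int[OF a] by blast
        have "a [^] (k mod int ?n) = a [^] k"
          using int_pow_eq[OF a] by (simp add: minus_mod_eq_mult_div)
        then have "x = ?f (k mod int ?n)" using k by simp
        moreover have "k mod int ?n \<in> carrier ?Z" using n C by simp
        ultimately show "x \<in> ?f ` carrier ?Z" by blast
      qed (use a in auto)
    qed
  qed
  then have "?Z \<cong> G" by (rule is_isoI)
  then show ?thesis using group.iso_sym[OF group_integer_mod_group] by blast
qed

lemma integer_mod_group_iso_cyclic: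
  assumes iso: "G \<cong> integer_mod_group n" and n: "n \<ge> 2"
  obtains a where "a \<in> carrier G" "ord a = n" "carrier G = cyc a"
proof -
  let ?Z = "integer_mod_group n"
  obtain f where f: "f \<in> iso ?Z G" using iso_sym[OF iso] by (auto simp: is_iso_def)
  interpret f: group_hom ?Z G f
    using f by (auto simp: group_hom_def group_hom_axioms_def iso_def)
  have C: "carrier ?Z = {0..<int n}" using n by (simp add: carrier_integer_mod_group)
  \<comment> \<open>The representatives are 0 to \<open>n - 1\<close>, so the generator 1 is
    available only for \<open>n \<ge> 2\<close>.\<close>
  have one: "1 \<in> carrier ?Z" using n by simp
  have bij: "bij_betw f (carrier ?Z) (carrier G)" using f by (simp add: iso_def)
  have a: "f 1 \<in> carrier G" using one by simp
  have "x \<in> cyc (f 1)" if "x \<in> carrier G" for x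
  proof -
    have "x \<in> f ` carrier ?Z" using that bij_betw_imp_surj_on[OF bij] by simp
    then obtain i where i: "i \<in> carrier ?Z" "x = f i" by (elim imageE)
    then have "i = 1 [^]\<^bsub>?Z\<^esub> i" using C by (simp add: int_pow_integer_mod_group)
    moreover have "f (1 [^]\<^bsub>?Z\<^esub> i) = f 1 [^] i" by (rule f.hom_int_pow[OF one])
    ultimately have "x = f 1 [^] i" using i(2) by simp
    then show ?thesis using cyc_int[OF a] by blast
  qed
  then have G: "carrier G = cyc (f 1)" using cyc_carrier[OF a] by blast
  have "card (carrier G) = n" using bij_betw_same_card[OF bij] C by simp
  then have "ord (f 1) = n" using generate_pow_card[OF a] G by simp
  then show ?thesis using that a G by blast
qed

end

section \<open>The presented generalized quaternion groups\<close>

context group begin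

lemma conj_by_inverted:
  assumes a: "a \<in> carrier G" and b: "b \<in> carrier G" and conj: "conj_by b a = inv a"
    and u: "u \<in> generate G {a}"
  shows "b \<otimes> u = inv u \<otimes> b"
proof -
  obtain k :: int where k: "u = a [^] k" using u generate_pow[OF a] by blast
  have "conj_by b (a [^] (- k)) = a [^] k"
    using conj_by_int_pow[OF b a, of "- k"] conj a by (simp add: int_pow_inv int_pow_neg)
  then have "a [^] (- k) \<otimes> b = b \<otimes> a [^] k" using conj_by_swap[OF b, of "a [^] (- k)"] a by simp
  then show ?thesis using k a by (simp add: int_pow_neg)
qed

text \<open>Used for the induction on words: left multiplication by any letter preserves the set of
  normal forms.\<close>

lemma quaternion_cosets_closed:
  assumes a: "a \<in> carrier G" and b: "b \<in> carrier G" and conj: "conj_by b a = inv a"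
    and bb: "b \<otimes> b \<in> generate G {a}"
    and c: "c \<in> {a, inv a, b, inv b}"
    and x: "x \<in> generate G {a} \<union> (\<lambda>x. x \<otimes> b) ` generate G {a}" (is "x \<in> ?C \<union> ?D")
  shows "c \<otimes> x \<in> ?C \<union> ?D"
proof -
  have S: "subgroup ?C G" using a by (intro generate_is_subgroup) simp
  have sub: "u \<in> carrier G" if "u \<in> ?C" for u using that subgroup.subset[OF S] by blast
  note mc = subgroup.m_closed[OF S] and ic = subgroup.m_inv_closed[OF S]
  have mult_C: "d \<otimes> y \<in> ?C \<union> ?D" if "d \<in> ?C" "y \<in> ?C \<union> ?D" for d y
    using that(2)
  proof
    assume "y \<in> ?C"
    then show ?thesis using mc that(1) by blast
  next
    assume "y \<in> ?D"
    then obtain u where u: "u \<in> ?C" "y = u \<otimes> b" by blast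
    then have "d \<otimes> y = (d \<otimes> u) \<otimes> b" using sub that(1) b by (simp add: m_assoc)
    then show ?thesis using mc that(1) u by blast
  qed
  have mult_b: "b \<otimes> y \<in> ?C \<union> ?D" if "y \<in> ?C \<union> ?D" for y
    using that
  proof
    assume "y \<in> ?C"
    then show ?thesis using conj_by_inverted[OF a b conj] ic by blast
  next
    assume "y \<in> ?D"
    then obtain u where u: "u \<in> ?C" "y = u \<otimes> b" by blast
    then have "b \<otimes> y = (b \<otimes> u) \<otimes> b" using sub b by (simp add: m_assoc)
    also have "\<dots> = inv u \<otimes> (b \<otimes> b)"
      using conj_by_inverted[OF a b conj u(1)] sub[OF u(1)] b by (simp add: m_assoc)
    finally show ?thesis using mc ic bb u by simp
  qed
  have ca: "a \<in> ?C" by (rule generate.incl) simp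
  \<comment> \<open>Rewriting \<open>inv b\<close> as \<open>inv (b \<otimes> b) \<otimes> b\<close>
    reduces this letter to \<open>b\<close> and an element of \<open>cyc a\<close>.\<close>
  have "inv b \<otimes> x = inv (b \<otimes> b) \<otimes> (b \<otimes> x)"
  proof -
    have "x \<in> carrier G" using x sub b by auto
    then have "inv (b \<otimes> b) \<otimes> (b \<otimes> x) = inv b \<otimes> ((inv b \<otimes> b) \<otimes> x)"
      using b by (simp only: inv_mult_group m_assoc inv_closed m_closed)
    then show ?thesis using b \<open>x \<in> carrier G\<close> by simp
  qed
  then have "inv b \<otimes> x \<in> ?C \<union> ?D" using mult_b[OF x] mult_C ic[OF bb] by simp
  then show ?thesis using c mult_C[OF _ x] mult_b[OF x] ca ic[OF ca] by blast
qed

end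

text \<open>
  Left multiplication by a letter on the normal forms \<open>x\<^sup>i\<close> and \<open>x\<^sup>iy\<close>, encoded as \<open>(i, False)\<close> and
  \<open>(i, True)\<close>. This action shows that \<open>x\<close> has order exactly \<open>2n\<close> in the presented group.
\<close>
fun quaternion_step :: "int \<Rightarrow> quaternion_gen \<times> bool \<Rightarrow> int \<times> bool \<Rightarrow> int \<times> bool" where
  "quaternion_step n (gen_x, True) (i, j) = ((i + 1) mod (2 * n), j)"
| "quaternion_step n (gen_x, False) (i, j) = ((i - 1) mod (2 * n), j)"
| "quaternion_step n (gen_y, True) (i, j) = ((if j then n - i else - i) mod (2 * n), \<not> j)"
| "quaternion_step n (gen_y, False) (i, j) = ((if j then - i else n - i) mod (2 * n), \<not> j)"

definition quaternion_act :: "int \<Rightarrow> quaternion_gen word \<Rightarrow> int \<times> bool \<Rightarrow> int \<times> bool" where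
  "quaternion_act n u s = foldr (quaternion_step n) u s"

lemma quaternion_act_simps [simp]:
  "quaternion_act n [] s = s"
  "quaternion_act n (l # u) s = quaternion_step n l (quaternion_act n u s)"
  "quaternion_act n (u @ v) s = quaternion_act n u (quaternion_act n v s)"
  by (simp_all add: quaternion_act_def)

text \<open>A letter and its inverse undo each other only on states whose first component is reduced
  modulo \<open>2 * n\<close>, so these states must be preserved.\<close>

lemma quaternion_act_states:
  "fst s mod (2 * n) = fst s \<Longrightarrow>
    fst (quaternion_act n u s) mod (2 * n) = fst (quaternion_act n u s)"
proof (induction u)
  case (Cons l u)
  obtain i j where "quaternion_act n u s = (i, j)" by fastforce
  moreover obtain g b where "l = (g, b)" by fastforce
  ultimately show ?case by (cases g; cases b) simp_all
qed simp

lemma quaternion_act_power: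
  "i mod (2 * n) = i \<Longrightarrow>
    quaternion_act n (replicate k (gen_x, True)) (i, j) = ((i + int k) mod (2 * n), j)"
  by (induction k) (simp_all add: mod_simps add_ac)

definition quaternion_rels :: "nat \<Rightarrow> (quaternion_gen word \<times> quaternion_gen word) set" where
  "quaternion_rels n =
     { (replicate n (gen_x, True), [(gen_y, True), (gen_y, True)]),
       (replicate (2 * n) (gen_x, True), []),
       (replicate 4 (gen_y, True), []),
       ([(gen_y, False), (gen_x, True), (gen_y, True)], [(gen_x, False)]) }"

lemma quaternion_rels_memb:
  "(replicate n (gen_x, True), [(gen_y, True), (gen_y, True)]) \<in> quaternion_rels n"
  "(replicate (2 * n) (gen_x, True), []) \<in> quaternion_rels n"
  "([(gen_y, False), (gen_x, True), (gen_y, True)], [(gen_x, False)]) \<in> quaternion_rels n"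
  by (simp_all add: quaternion_rels_def)

lemma generalized_quaternion_eq: "generalized_quaternion n = presented_group (quaternion_rels n)"
  by (simp add: generalized_quaternion_def quaternion_rels_def)

text \<open>Induction over the congruence shows that the presented group acts on reduced states.
  This gives lower bounds that the relations alone do not show.\<close>

lemma quaternion_act_word_eq:
  assumes "word_eq (quaternion_rels n) u v" "fst s mod (2 * int n) = fst s"
  shows "quaternion_act (int n) u s = quaternion_act (int n) v s"
  using assms
proof (induction arbitrary: s)
  case (mult u v u' v')
  then show ?case using quaternion_act_states by simp
next
  case (cancel g b)
  obtain i j where "s = (i, j)" by fastforce
  with cancel show ?case by (cases g; cases b; cases j) (simp_all add: mod_simps)
next
  case (rel u v)
  obtain i j where s: "s = (i, j)" by fastforce
  \<comment> \<open>The two sides of the relation \<open>x\<^sup>n = y\<^sup>2\<close> shift by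
    \<open>n\<close> and by \<open>- n\<close>, depending on the state, which is the same modulo
    \<open>2 * n\<close>.\<close>
  have shift: "(i + int n) mod (2 * int n) = (i - int n) mod (2 * int n)"
    "(int n + i) mod (2 * int n) = (i - int n) mod (2 * int n)"
    by (simp_all add: mod_eq_dvd_iff)
  have full: "(i + 2 * int n) mod (2 * int n) = i" using rel s by simp
  from rel show ?case
    unfolding quaternion_rels_def using s shift full
    by (cases j) (auto simp: quaternion_act_power numeral_eq_Suc mod_simps)
qed simp_all

section \<open>Evaluation of words and the universal property of a presentation\<close>

definition word_value :: "('g, 'h) monoid_scheme \<Rightarrow> ('a \<Rightarrow> 'g) \<Rightarrow> 'a word \<Rightarrow> 'g" where
  "word_value H f u = foldr (\<lambda>(g, b) x. (if b then f g else inv\<^bsub>H\<^esub> f g) \<otimes>\<^bsub>H\<^esub> x) u \<one>\<^bsub>H\<^esub>"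

context group begin

lemma word_value_simps [simp]:
  "word_value G f [] = \<one>"
  "word_value G f ((g, b) # u) = (if b then f g else inv f g) \<otimes> word_value G f u"
  by (simp_all add: word_value_def)

lemma word_value_closed [simp]:
  "(\<And>g. f g \<in> carrier G) \<Longrightarrow> word_value G f u \<in> carrier G"
  by (induction u) auto

lemma word_value_append:
  "(\<And>g. f g \<in> carrier G) \<Longrightarrow> word_value G f (u @ v) = word_value G f u \<otimes> word_value G f v"
  by (induction u) (auto simp: m_assoc)

lemma word_value_replicate:
  "(\<And>g. f g \<in> carrier G) \<Longrightarrow> word_value G f (replicate k (g, True)) = f g [^] k"
proof (induction k)
  case (Suc k)
  then show ?case using nat_pow_Suc2[of "f g" k] by simp
qed simp

lemma word_value_word_eq:
  assumes f: "\<And>g. f g \<in> carrier G"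
    and R: "\<And>u v. (u, v) \<in> R \<Longrightarrow> word_value G f u = word_value G f v"
    and "word_eq R u v"
  shows "word_value G f u = word_value G f v"
  using assms(3)
proof induction
  case (cancel g b)
  then show ?case using f by simp
qed (auto simp: f R word_value_append)

text \<open>This is von Dyck's theorem: an assignment of the generators that respects the relations
  extends to a homomorphism.\<close>

lemma presented_group_hom:
  assumes f: "\<And>g. f g \<in> carrier G"
    and R: "\<And>u v. (u, v) \<in> R \<Longrightarrow> word_value G f u = word_value G f v"
  obtains \<phi> where "group_hom (presented_group R) G \<phi>"
    "\<And>u. \<phi> (word_class R u) = word_value G f u"
proof -
  \<comment> \<open>The value does not depend on the chosen representative, by
    \<open>word_value_word_eq\<close>.\<close>
  define \<phi> where "\<phi> A = word_value G f (SOME u. u \<in> A)" for A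
  have \<phi>: "\<phi> (word_class R u) = word_value G f u" for u
  proof -
    have "u \<in> word_class R u" by (simp add: word_class_def word_eq.refl)
    then have "(SOME v. v \<in> word_class R u) \<in> word_class R u" by (rule someI)
    then have "word_eq R u (SOME v. v \<in> word_class R u)" by (simp add: word_class_def)
    then show ?thesis using word_value_word_eq[OF f R] by (simp add: \<phi>_def)
  qed
  have "\<phi> \<in> hom (presented_group R) G"
  proof (rule homI)
    fix A B assume "A \<in> carrier (presented_group R)" "B \<in> carrier (presented_group R)"
    then obtain u v where "A = word_class R u" "B = word_class R v"
      by (auto simp: presented_group_def)
    then show "\<phi> (A \<otimes>\<^bsub>presented_group R\<^esub> B) = \<phi> A \<otimes> \<phi> B"
      by (simp add: mult_presented_group \<phi> word_value_append f)
  qed (auto simp: presented_group_def \<phi> f)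
  then have "group_hom (presented_group R) G \<phi>"
    by (intro group_hom.intro group_hom_axioms.intro group_presented_group is_group)
  then show ?thesis using that \<phi> by blast
qed

end

lemma word_class_replicate:
  "word_class R (replicate k l) = word_class R [l] [^]\<^bsub>presented_group R\<^esub> k"
proof (induction k)
  case 0
  then show ?case by (simp add: presented_group_def nat_pow_def)
next
  case (Suc k)
  interpret group "presented_group R" by (rule group_presented_group)
  have "word_class R [l] \<in> carrier (presented_group R)" by (simp add: presented_group_def)
  then show ?case
    using Suc nat_pow_Suc2[of "word_class R [l]" k] mult_presented_group[of R "[l]" "replicate k l"]
    by simp
qed

text \<open>The relations give the equations and reduce every word to normal form. The action on the
  state \<open>(0, False)\<close> shows that the order of \<open>X\<close> is no smaller and that
  \<open>Y\<close> is not a power of \<open>X\<close>.\<close>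

lemma generalized_quaternion_gens:
  assumes n: "n \<ge> 1"
  defines "Q \<equiv> generalized_quaternion n"
  defines "X \<equiv> word_class (quaternion_rels n) [(gen_x, True)]"
    and "Y \<equiv> word_class (quaternion_rels n) [(gen_y, True)]"
  shows "group.quaternion_gens Q X Y n"
proof -
  let ?R = "quaternion_rels n"
  have Q: "Q = presented_group ?R" by (simp add: Q_def generalized_quaternion_eq)
  interpret Q: group Q unfolding Q by (rule group_presented_group)
  note mult = mult_presented_group[of ?R, folded Q]
  have carrier: "word_class ?R u \<in> carrier Q" for u by (simp add: Q presented_group_def)
  have one: "\<one>\<^bsub>Q\<^esub> = word_class ?R []" by (simp add: Q presented_group_def)
  have X: "X \<in> carrier Q" and Y: "Y \<in> carrier Q" using carrier by (simp_all add: X_def Y_def)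
  have Xk: "X [^]\<^bsub>Q\<^esub> k = word_class ?R (replicate k (gen_x, True))" for k :: nat
    by (simp add: word_class_replicate X_def Q)
  have inv: "inv\<^bsub>Q\<^esub> word_class ?R [(g, True)] = word_class ?R [(g, False)]" for g
    using word_eq.cancel[of ?R g False] carrier
    by (intro Q.inv_equality) (simp_all add: mult one word_class_eq_iff)
  have rel: "word_class ?R u = word_class ?R v" if "(u, v) \<in> ?R" for u v
    using that by (simp add: word_class_eq_iff word_eq.rel)
  have YY: "Y \<otimes>\<^bsub>Q\<^esub> Y = X [^]\<^bsub>Q\<^esub> n"
    using rel[OF quaternion_rels_memb(1)] by (simp add: Xk Y_def mult)
  have X2n: "X [^]\<^bsub>Q\<^esub> (2 * n) = \<one>\<^bsub>Q\<^esub>"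
    using rel[OF quaternion_rels_memb(2)] by (simp add: Xk one)
  have conj: "Q.conj_by Y X = inv\<^bsub>Q\<^esub> X"
    using rel[OF quaternion_rels_memb(3)] by (simp add: Q.conj_by_def X_def Y_def inv mult)
  have act: "quaternion_act (int n) u (0, False) = quaternion_act (int n) v (0, False)"
    if "word_class ?R u = word_class ?R v" for u v
    using that by (intro quaternion_act_word_eq) (simp_all add: word_class_eq_iff)
  have "X [^]\<^bsub>Q\<^esub> k = \<one>\<^bsub>Q\<^esub> \<longleftrightarrow> 2 * n dvd k" for k :: nat
  proof
    assume "X [^]\<^bsub>Q\<^esub> k = \<one>\<^bsub>Q\<^esub>"
    then have "int k mod (2 * int n) = 0"
      using act[of "replicate k (gen_x, True)" "[]"] by (simp add: Xk one quaternion_act_power)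
    then have "int (2 * n) dvd int k" by (simp add: dvd_eq_mod_eq_0)
    then show "2 * n dvd k" by (simp only: int_dvd_int_iff)
  next
    assume "2 * n dvd k"
    then obtain l where "k = 2 * n * l" by blast
    then have "X [^]\<^bsub>Q\<^esub> k = (X [^]\<^bsub>Q\<^esub> (2 * n)) [^]\<^bsub>Q\<^esub> l" using X by (simp only: Q.nat_pow_pow)
    then show "X [^]\<^bsub>Q\<^esub> k = \<one>\<^bsub>Q\<^esub>" using X2n by simp
  qed
  then have ord: "Q.ord X = 2 * n" using Q.ord_unique[OF X] by blast
  have gen: "generate Q {X} = {X [^]\<^bsub>Q\<^esub> k | k. k \<in> (UNIV :: nat set)}"
    using Q.generate_pow_nat[OF X] ord n by simp
  \<comment> \<open>The letter \<open>y\<close> flips the Boolean component of the state, while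
    powers of \<open>x\<close> keep it.\<close>
  have "Y \<notin> generate Q {X}"
  proof
    assume "Y \<in> generate Q {X}"
    then obtain k :: nat where "Y = X [^]\<^bsub>Q\<^esub> k" using gen by blast
    then show False
      using act[of "[(gen_y, True)]" "replicate k (gen_x, True)"]
      by (simp add: Xk Y_def quaternion_act_power)
  qed
  moreover have "carrier Q = generate Q {X} \<union> (\<lambda>x. x \<otimes>\<^bsub>Q\<^esub> Y) ` generate Q {X}" (is "_ = ?S")
  proof
    have "word_class ?R u \<in> ?S" for u
    proof (induction u)
      case Nil
      then show ?case using generate.one[of Q "{X}"] one by simp
    next
      case (Cons l u)
      obtain g b where l: "l = (g, b)" by fastforce
      have "word_class ?R [l] \<in> {X, inv\<^bsub>Q\<^esub> X, Y, inv\<^bsub>Q\<^esub> Y}"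
        by (cases g; cases b) (simp_all add: l X_def Y_def inv)
      moreover have "Y \<otimes>\<^bsub>Q\<^esub> Y \<in> generate Q {X}" using YY gen by blast
      ultimately have "word_class ?R [l] \<otimes>\<^bsub>Q\<^esub> word_class ?R u \<in> ?S"
        using Cons.IH by (intro Q.quaternion_cosets_closed[OF X Y conj])
      then show ?case by (simp add: mult)
    qed
    then show "carrier Q \<subseteq> ?S" by (auto simp: Q presented_group_def)
    show "?S \<subseteq> carrier Q" using Q.generate_incl[of "{X}"] X Y by auto
  qed
  ultimately show ?thesis using X Y ord YY conj by (simp add: Q.quaternion_gens_def)
qed

section \<open>Recognising the quaternion groups up to isomorphism\<close>

lemma quaternion_gens_image:
  assumes hom: "group_hom H G f" and bij: "bij_betw f (carrier H) (carrier G)"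
    and q: "group.quaternion_gens H a b n"
  shows "group.quaternion_gens G (f a) (f b) n"
proof -
  interpret f: group_hom H G f by fact
  have a: "a \<in> carrier H" and b: "b \<in> carrier H" and o: "f.G.ord a = 2 * n"
    and nb: "b \<notin> generate H {a}" and bb: "b \<otimes>\<^bsub>H\<^esub> b = a [^]\<^bsub>H\<^esub> n"
    and conj: "f.G.conj_by b a = inv\<^bsub>H\<^esub> a"
    and C: "carrier H = generate H {a} \<union> (\<lambda>x. x \<otimes>\<^bsub>H\<^esub> b) ` generate H {a}"
    using q by (auto simp: f.G.quaternion_gens_def)
  have inj: "inj_on f (carrier H)" and surj: "f ` carrier H = carrier G"
    using bij by (auto simp: bij_betw_def)
  have gen: "generate G {f a} = f ` generate H {a}" using f.generate_img[of "{a}"] a by simp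
  have sub: "generate H {a} \<subseteq> carrier H" using f.G.generate_incl[of "{a}"] a by simp
  have "f a [^]\<^bsub>G\<^esub> k = \<one>\<^bsub>G\<^esub> \<longleftrightarrow> 2 * n dvd k" for k :: nat
  proof -
    have "f a [^]\<^bsub>G\<^esub> k = f (a [^]\<^bsub>H\<^esub> k)" using f.hom_nat_pow[OF a] by simp
    moreover have "f (a [^]\<^bsub>H\<^esub> k) = f \<one>\<^bsub>H\<^esub> \<longleftrightarrow> a [^]\<^bsub>H\<^esub> k = \<one>\<^bsub>H\<^esub>"
      using inj a by (intro inj_on_eq_iff) auto
    ultimately show ?thesis using f.G.pow_eq_id[OF a] o by simp
  qed
  then have "f.H.ord (f a) = 2 * n" using f.H.ord_unique a by simp
  moreover have "f b \<notin> generate G {f a}" using gen nb inj b sub by (auto dest: inj_onD)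
  moreover have "f b \<otimes>\<^bsub>G\<^esub> f b = f a [^]\<^bsub>G\<^esub> n"
    using f.hom_mult[OF b b] bb f.hom_nat_pow[OF a] by simp
  moreover have "f.H.conj_by (f b) (f a) = inv\<^bsub>G\<^esub> f a"
  proof -
    have "f (f.G.conj_by b a) = f.H.conj_by (f b) (f a)"
      using a b by (simp add: f.G.conj_by_def f.H.conj_by_def)
    then show ?thesis using conj a by simp
  qed
  moreover have "carrier G = generate G {f a} \<union> (\<lambda>x. x \<otimes>\<^bsub>G\<^esub> f b) ` generate G {f a}"
  proof -
    have "f ` (\<lambda>x. x \<otimes>\<^bsub>H\<^esub> b) ` generate H {a} = (\<lambda>x. x \<otimes>\<^bsub>G\<^esub> f b) ` f ` generate H {a}"
      unfolding image_image using sub b by (intro image_cong) auto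
    then show ?thesis unfolding gen surj[symmetric] using C by (metis image_Un)
  qed
  ultimately show ?thesis
    unfolding f.H.quaternion_gens_def using f.hom_closed[OF a] f.hom_closed[OF b] by blast
qed

context finite_group begin

lemma iso_generalized_quaternion_imp_gens:
  assumes iso: "G \<cong> generalized_quaternion n" and n: "n \<ge> 1"
  obtains a b where "quaternion_gens a b n"
proof -
  let ?Q = "generalized_quaternion n"
  have Q: "group ?Q" by (simp add: generalized_quaternion_eq group_presented_group)
  obtain f where f: "f \<in> iso ?Q G" using iso_sym[OF iso] by (auto simp: is_iso_def)
  have "group_hom ?Q G f"
    using f Q by (auto simp: group_hom_def group_hom_axioms_def iso_def)
  then show ?thesis
    using quaternion_gens_image[OF _ _ generalized_quaternion_gens[OF n]] f that by (auto simp: iso_def)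
qed

text \<open>The universal property gives a homomorphism from the presented group, surjective because
  both groups are described by the same normal forms. Its kernel is trivial: \<open>X\<close> and
  \<open>a\<close> have the same order, and an element of the second coset mapped to the identity
  would put \<open>b\<close> into \<open>cyc a\<close>.\<close>

lemma quaternion_gens_imp_iso:
  assumes q: "quaternion_gens a b n"
  shows "G \<cong> generalized_quaternion n"
proof -
  let ?Q = "generalized_quaternion n" and ?R = "quaternion_rels n"
  have a: "a \<in> carrier G" and b: "b \<in> carrier G" and o: "ord a = 2 * n"
    and nb: "b \<notin> cyc a" and bb: "b \<otimes> b = a [^] n" and conj: "conj_by b a = inv a"
    and C: "carrier G = cyc a \<union> (\<lambda>x. x \<otimes> b) ` cyc a"
    using q by (auto simp: quaternion_gens_def)
  have n: "n \<ge> 1" using ord_pos[OF a] o by simp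
  let ?f = "\<lambda>g. case g of gen_x \<Rightarrow> a | gen_y \<Rightarrow> b"
  have f: "?f g \<in> carrier G" for g using a b by (cases g) auto
  have a2n: "a [^] (2 * n) = \<one>" using pow_ord_eq_1[OF a] o by simp
  have b4: "b [^] (4::nat) = \<one>"
  proof -
    have "b [^] (4::nat) = (b \<otimes> b) \<otimes> (b \<otimes> b)" using b by (simp add: numeral_eq_Suc m_assoc)
    then show ?thesis using bb a a2n by (simp add: nat_pow_mult mult_2)
  qed
  have R: "word_value G ?f u = word_value G ?f v" if "(u, v) \<in> ?R" for u v
    using that f a b a2n b4 bb conj unfolding quaternion_rels_def
    by (auto simp: word_value_replicate[OF f] conj_by_def m_assoc)
  obtain \<phi> where hom: "group_hom (presented_group ?R) G \<phi>"
    and \<phi>: "\<And>u. \<phi> (word_class ?R u) = word_value G ?f u"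
    using presented_group_hom[OF f R] by blast
  interpret \<phi>: group_hom ?Q G \<phi> using hom by (simp add: generalized_quaternion_eq)
  let ?X = "word_class ?R [(gen_x, True)]" and ?Y = "word_class ?R [(gen_y, True)]"
  have X: "?X \<in> carrier ?Q" and Y: "?Y \<in> carrier ?Q"
    and oX: "\<phi>.G.ord ?X = 2 * n"
    and CQ: "carrier ?Q = generate ?Q {?X} \<union> (\<lambda>x. x \<otimes>\<^bsub>?Q\<^esub> ?Y) ` generate ?Q {?X}"
    using generalized_quaternion_gens[OF n] by (auto simp: \<phi>.G.quaternion_gens_def)
  have \<phi>X: "\<phi> ?X = a" and \<phi>Y: "\<phi> ?Y = b" using a b by (simp_all add: \<phi>)
  have gen: "cyc a = \<phi> ` generate ?Q {?X}" using \<phi>.generate_img[of "{?X}"] X \<phi>X by simp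
  have genQ: "generate ?Q {?X} \<subseteq> carrier ?Q" using \<phi>.G.generate_incl[of "{?X}"] X by simp
  have surj: "\<phi> ` carrier ?Q = carrier G"
  proof -
    have "\<phi> ` (\<lambda>x. x \<otimes>\<^bsub>?Q\<^esub> ?Y) ` generate ?Q {?X} = (\<lambda>x. x \<otimes> b) ` \<phi> ` generate ?Q {?X}"
      unfolding image_image using genQ Y \<phi>Y by (intro image_cong) auto
    then show ?thesis using C CQ gen by (metis image_Un)
  qed
  have "x = \<one>\<^bsub>?Q\<^esub>" if x: "x \<in> carrier ?Q" "\<phi> x = \<one>" for x
  proof -
    from x(1) CQ consider "x \<in> generate ?Q {?X}"
      | u where "u \<in> generate ?Q {?X}" "x = u \<otimes>\<^bsub>?Q\<^esub> ?Y" by blast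
    then show ?thesis
    proof cases
      case 1
      then obtain k :: int where k: "x = ?X [^]\<^bsub>?Q\<^esub> k" using \<phi>.G.generate_pow[OF X] by auto
      then have "a [^] k = \<one>" using x(2) \<phi>.hom_int_pow[OF X] \<phi>X by simp
      then show ?thesis using k int_pow_eq_id[OF a] \<phi>.G.int_pow_eq_id[OF X] o oX by simp
    next
      case (2 u)
      then have "\<phi> u \<in> cyc a" "u \<in> carrier ?Q" using gen genQ by auto
      moreover from this have "\<phi> u \<otimes> b = \<one>" using 2 x(2) Y \<phi>Y by simp
      ultimately have "inv (\<phi> u) = b" using b by (metis inv_equality inv_inv \<phi>.hom_closed inv_comm)
      then have "b \<in> cyc a"
        using subgroup.m_inv_closed[OF cyc_subgroup[OF a] \<open>\<phi> u \<in> cyc a\<close>] by simp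
      then show ?thesis using nb by blast
    qed
  qed
  then have "inj_on \<phi> (carrier ?Q)"
    by (auto simp: \<phi>.inj_iff_trivial_ker kernel_def)
  then have "\<phi> \<in> iso ?Q G" using surj \<phi>.homh by (simp add: iso_def bij_betw_def)
  then show ?thesis using \<phi>.G.iso_sym is_isoI by blast
qed

end

section \<open>The strong metric dimension\<close>

theorem theorem5p1:
  fixes G :: "('a, 'b) monoid_scheme" and n :: nat
  assumes "group G" and "finite (carrier G)" and "order G = n"
  shows "(\<forall>k::nat. k \<ge> 1 \<and> G \<cong> integer_mod_group (2 ^ k) \<longrightarrow>
            int (sdim (reduced_power_graph G)) = 2 ^ k - int k) \<and>
         (\<forall>t::nat. t \<ge> 1 \<and> G \<cong> generalized_quaternion (2 ^ t) \<longrightarrow>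
            int (sdim (reduced_power_graph G)) = 2 ^ (t + 2) - int t - 1) \<and>
         (\<not> (\<exists>k::nat. k \<ge> 1 \<and> G \<cong> integer_mod_group (2 ^ k)) \<and>
          \<not> (\<exists>t::nat. t \<ge> 1 \<and> G \<cong> generalized_quaternion (2 ^ t)) \<longrightarrow>
            int (sdim (reduced_power_graph G)) =
              int n - int (Max {num_prime_factors m | m. m \<in> element_orders G}) - 1)"
proof (intro conjI allI impI)
  interpret finite_group G using assms by (simp add: finite_group_def finite_group_axioms_def)
  {
    fix k :: nat assume k: "k \<ge> 1 \<and> G \<cong> integer_mod_group (2 ^ k)"
    then obtain l where l: "k = Suc l" by (cases k) auto
    have "(2::nat) ^ k \<ge> 2" by (simp add: l)
    with k obtain a where "a \<in> carrier G" "ord a = 2 ^ Suc l" "carrier G = cyc a"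
      using integer_mod_group_iso_cyclic l by metis
    note C = cyclic_two_group[OF this]
    show "int (sdim (reduced_power_graph G)) = 2 ^ k - int k"
      \<comment> \<open>The group order is \<open>2 ^ k\<close> and \<open>max_Omega\<close> is
        \<open>k\<close>; the usual further \<open>- 1\<close> is absent because of the twin of the
        identity.\<close>
      using sdim_dominating[OF C(2)] C(1,3) l by simp
  next
    fix t :: nat assume t: "t \<ge> 1 \<and> G \<cong> generalized_quaternion (2 ^ t)"
    then obtain a b where "quaternion_gens a b (2 ^ t)"
      using iso_generalized_quaternion_imp_gens[of "2 ^ t"] by auto
    note Q = quaternion_two_group[OF this conjunct1[OF t]]
    show "int (sdim (reduced_power_graph G)) = 2 ^ (t + 2) - int t - 1"
      \<comment> \<open>The final \<open>- 1\<close> comes from \<open>max_Omega = t + 1\<close>,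
        the exponent of the cyclic subgroup of index 2.\<close>
      using sdim_dominating[OF Q(2)] Q(1,3) by simp
  next
    assume N: "\<not> (\<exists>k::nat. k \<ge> 1 \<and> G \<cong> integer_mod_group (2 ^ k)) \<and>
      \<not> (\<exists>t::nat. t \<ge> 1 \<and> G \<cong> generalized_quaternion (2 ^ t))"
    \<comment> \<open>A dominating involution would make the group one of the two excluded kinds, so
      there are no twins.\<close>
    have "\<not> dominating y" for y
    proof
      assume "dominating y"
      then show False
      proof (cases rule: dominating_cyclic_or_quaternion)
        case (1 a k)
        then show False using cyclic_iso_integer_mod_group[of a] N by metis
      next
        case (2 a b t)
        then show False using quaternion_gens_imp_iso N by blast
      qed
    qed
    from sdim_not_dominating[OF this]
    show "int (sdim (reduced_power_graph G)) =
        int n - int (Max {num_prime_factors m | m. m \<in> element_orders G}) - 1"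
      using assms(3) by (simp add: max_Omega_def)
  }
qed

end
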